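(* Let $w\in S_n$. Let $Y$ denote the maximum, over all reduced decompositions $\rho$ of $w$, of the number of long braid moves that $\rho$ has. Then $$2^{\lceil Y/2\rceil}+N_{321}(w)-\left\lceil \tfrac{Y}{2}\right\rceil\ \le\ |G(w)|\ <\ 3^{l(w)},$$ where $|G(w)|$ denotes the number of vertices of the graph $G(w)$.
   Context: For $w\in S_n$, written in one-line notation $w(1)w(2)\cdots w(n)$, $l(w)$ is the number of inversions, i.e. the number of pairs $i<j$ with $w(i)>w(j)$. A reduced decomposition of $w$ is a sequence $(i_1,\ldots,i_{l(w)})$ with entries in $\{1,\ldots,n-1\}$ such that $w=s_{i_1}s_{i_2}\cdots s_{i_{l(w)}}$, where $s_i$ is the adjacent transposition swapping the entries in positions $i$ and $i+1$ (so $w$ is obtained from $12\cdots n$ by successively swapping the entries in positions $i_k,i_k+1$ for $k=1,2,\ldots$). A short braid move replaces two consecutive entries $i,j$ with $|i-j|\ge 2$ by $j,i$. A long braid move replaces three consecutive entries $i,i+1,i$ by $i+1,i,i+1$, or vice versa. The number of long braid moves that a reduced decomposition has is the number of places (three consecutive entries) at which a long braid move can be applied to it. Two reduced decompositions of $w$ are in the same commutation class if one can be obtained from the other by a sequence of short braid moves. $G(w)$ is the graph whose vertices are the commutation classes of reduced decompositions of $w$, two vertices being joined by an edge if there is a long braid move between some reduced decomposition in the first class and some reduced decomposition in the second class. $N_{321}(w)$ is the number of $321$-patterns in $w$, i.e. the number of triples $i_1<i_2<i_3$ with $w(i_1)>w(i_2)>w(i_3)$.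
   Formalization: The strict upper bound |G(w)| < 3^{l(w)} is asserted only for w other than the identity, since for the identity both sides equal 1; the lower bound is asserted for all w. *)

theory Defs
  imports Complex_Main "HOL-Combinatorics.Permutations" "Graph_Theory.Pair_Digraph"
begin

text \<open>A permutation in \<open>S\<^sub>n\<close> is a function \<open>w\<close> with \<open>w permutes {1..n}\<close>;
  it fixes all natural numbers outside \<open>{1..n}\<close>.\<close>

definition inversion_number :: "nat \<Rightarrow> (nat \<Rightarrow> nat) \<Rightarrow> nat" where
  "inversion_number n w =
     card {(i, j). i \<in> {1..n} \<and> j \<in> {1..n} \<and> i < j \<and> w i > w j}"

definition num_321_patterns :: "nat \<Rightarrow> (nat \<Rightarrow> nat) \<Rightarrow> nat" where
  "num_321_patterns n w =
     card {(i, j, k). i \<in> {1..n} \<and> j \<in> {1..n} \<and> k \<in> {1..n} \<and>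
                      i < j \<and> j < k \<and> w i > w j \<and> w j > w k}"

definition adj_transp :: "nat \<Rightarrow> nat \<Rightarrow> nat" where
  "adj_transp i = transpose i (Suc i)"

text \<open>Composing with \<^term>\<open>adj_transp i\<close> on the right swaps the entries of the one-line notation
  in positions \<open>i\<close> and \<open>i + 1\<close>.\<close>

definition word_perm :: "nat list \<Rightarrow> nat \<Rightarrow> nat" where
  "word_perm \<rho> = foldr (\<circ>) (map adj_transp \<rho>) id"

definition reduced_decomps :: "nat \<Rightarrow> (nat \<Rightarrow> nat) \<Rightarrow> nat list set" where
  "reduced_decomps n w =
     {\<rho>. length \<rho> = inversion_number n w \<and> set \<rho> \<subseteq> {1..n - 1} \<and> word_perm \<rho> = w}"

definition short_braid :: "nat list \<Rightarrow> nat list \<Rightarrow> bool" where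
  "short_braid \<rho> \<sigma> \<longleftrightarrow>
     (\<exists>us vs i j. (i + 2 \<le> j \<or> j + 2 \<le> i) \<and> \<rho> = us @ [i, j] @ vs \<and> \<sigma> = us @ [j, i] @ vs)"

definition long_braid_at :: "nat \<Rightarrow> nat list \<Rightarrow> nat list \<Rightarrow> bool" where
  "long_braid_at k \<rho> \<sigma> \<longleftrightarrow>
     (\<exists>us vs i. length us = k \<and>
        (\<rho> = us @ [i, i + 1, i] @ vs \<and> \<sigma> = us @ [i + 1, i, i + 1] @ vs \<or>
         \<rho> = us @ [i + 1, i, i + 1] @ vs \<and> \<sigma> = us @ [i, i + 1, i] @ vs))"

definition num_long_braids :: "nat list \<Rightarrow> nat" where
  "num_long_braids \<rho> = card {k. \<exists>\<sigma>. long_braid_at k \<rho> \<sigma>}"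

text \<open>\<^const>\<open>Max\<close> is meaningful here: the set of reduced decompositions of a permutation is
  nonempty, and it is finite by \<open>finite_reduced_decomps\<close> below.\<close>

definition max_long_braids :: "nat \<Rightarrow> (nat \<Rightarrow> nat) \<Rightarrow> nat" where
  "max_long_braids n w = Max (num_long_braids ` reduced_decomps n w)"

definition commutation_rel :: "nat \<Rightarrow> (nat \<Rightarrow> nat) \<Rightarrow> nat list rel" where
  "commutation_rel n w =
     {(\<rho>, \<sigma>). \<rho> \<in> reduced_decomps n w \<and> \<sigma> \<in> reduced_decomps n w \<and> short_braid\<^sup>*\<^sup>* \<rho> \<sigma>}"

definition commutation_classes :: "nat \<Rightarrow> (nat \<Rightarrow> nat) \<Rightarrow> nat list set set" where
  "commutation_classes n w = reduced_decomps n w // commutation_rel n w"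

text \<open>Following \<open>Graph_Theory\<close>, an undirected graph is a symmetric loop-free digraph;
  see \<open>pair_graph_commutation_graph\<close> below.\<close>

definition commutation_graph :: "nat \<Rightarrow> (nat \<Rightarrow> nat) \<Rightarrow> nat list set pair_pre_digraph" where
  "commutation_graph n w =
     \<lparr> pverts = commutation_classes n w,
       parcs = {(C, D). C \<in> commutation_classes n w \<and> D \<in> commutation_classes n w \<and>
                        (\<exists>\<rho>\<in>C. \<exists>\<sigma>\<in>D. \<exists>k. long_braid_at k \<rho> \<sigma>)} \<rparr>"

lemma finite_reduced_decomps: "finite (reduced_decomps n w)"
  by (rule finite_subset[OF _ finite_lists_length_eq[of "{1..n - 1}" "inversion_number n w"]])
     (auto simp: reduced_decomps_def)

lemma sym_short_braid: "short_braid \<rho> \<sigma> \<Longrightarrow> short_braid \<sigma> \<rho>"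
  unfolding short_braid_def by blast

lemma equiv_commutation_rel: "equiv (reduced_decomps n w) (commutation_rel n w)"
proof (rule equivI)
  show "commutation_rel n w \<subseteq> reduced_decomps n w \<times> reduced_decomps n w"
    by (auto simp: commutation_rel_def)
  show "refl_on (reduced_decomps n w) (commutation_rel n w)"
    by (auto simp: refl_on_def commutation_rel_def)
  have "symp short_braid\<^sup>*\<^sup>*"
    by (rule symp_rtranclp, rule sympI, erule sym_short_braid)
  then show "sym (commutation_rel n w)"
    unfolding sym_def commutation_rel_def by (blast dest: sympD)
  show "trans (commutation_rel n w)"
    by (auto simp: trans_def commutation_rel_def)
qed

lemma sum_list_short_braid: "short_braid\<^sup>*\<^sup>* \<rho> \<sigma> \<Longrightarrow> sum_list \<rho> = sum_list \<sigma>"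
  by (induction rule: rtranclp_induct) (auto simp: short_braid_def)

lemma pair_graph_commutation_graph: "pair_graph (commutation_graph n w)"
proof
  let ?G = "commutation_graph n w"
  have fin: "finite (commutation_classes n w)"
    unfolding commutation_classes_def
    by (rule finite_quotient[OF finite_reduced_decomps])
       (auto simp: commutation_rel_def)
  show "finite (pverts ?G)"
    using fin by (simp add: commutation_graph_def)
  show "finite (parcs ?G)"
    by (rule finite_subset[OF _ finite_cartesian_product[OF fin fin]])
       (auto simp: commutation_graph_def)
  show "fst e \<in> pverts ?G" "snd e \<in> pverts ?G" if "e \<in> parcs ?G" for e
    using that by (auto simp: commutation_graph_def)
  have "long_braid_at k \<sigma> \<rho>" if "long_braid_at k \<rho> \<sigma>" for k \<rho> \<sigma>
    using that unfolding long_braid_at_def by blast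
  then show "symmetric (with_proj ?G)"
    unfolding symmetric_def sym_def commutation_graph_def by simp blast
  show "fst e \<noteq> snd e" if e: "e \<in> parcs ?G" for e
  proof
    assume eq: "fst e = snd e"
    from e eq obtain C \<rho> \<sigma> k where C: "C \<in> commutation_classes n w" "\<rho> \<in> C" "\<sigma> \<in> C"
      and lb: "long_braid_at k \<rho> \<sigma>"
      by (auto simp: commutation_graph_def)
    have "(\<rho>, \<sigma>) \<in> commutation_rel n w"
      using quotient_eq_iff[OF equiv_commutation_rel, of C n w C \<rho> \<sigma>] C
      by (simp add: commutation_classes_def)
    then have "sum_list \<rho> = sum_list \<sigma>"
      by (auto simp: commutation_rel_def dest: sum_list_short_braid)
    with lb show False by (auto simp: long_braid_at_def)
  qed
qed

end

theory Submission
  imports Defs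
begin

text \<open>Lower bound: recording for every \<open>321\<close>-pattern \<open>z y x\<close> whether \<open>x, y\<close> are exchanged before
  \<open>y, z\<close> gives an invariant of commutation classes, one entry of which is changed by a long braid move. Among the \<open>Y\<close> places of an optimal word every other one can be chosen to be disjoint, which
  yields \<open>2\<^sup>y\<close> classes, \<open>y = \<lceil>Y/2\<rceil>\<close>, agreeing on all but \<open>y\<close> patterns. Every pattern occurs with both
  orientations and all words are connected by braid moves, so growing the cube along paths until the
  remaining \<open>N\<^sub>3\<^sub>2\<^sub>1 - y\<close> patterns have been flipped needs at least that many further classes.

  Upper bound: record for every position the last letter of the word affecting it. If \<open>i\<close> is this
  letter at \<open>i\<close> and at \<open>i + 1\<close>, it can be moved to the end of the word and removed; afterwards it is
  not again \<open>i\<close> at both positions, which leaves three of four combinations. Weighting by \<open>1/2\<close> every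
  position which is the middle of a \<open>321\<close>-pattern, and so has two choices, makes the initial number of
  choices cancel, and each letter contributes a factor of at most \<open>3\<close>.\<close>

section \<open>Reduced decompositions\<close>

lemma adj_transp_simps [simp]:
  "adj_transp i i = Suc i" "adj_transp i (Suc i) = i"
  "adj_transp i (adj_transp i x) = x" "adj_transp i \<circ> adj_transp i = id"
  by (auto simp: adj_transp_def fun_eq_iff)

lemma adj_transp_other: "x \<noteq> i \<Longrightarrow> x \<noteq> Suc i \<Longrightarrow> adj_transp i x = x"
  by (simp add: adj_transp_def)

lemma adj_transp_eq: "adj_transp i x = (if x = i then Suc i else if x = Suc i then i else x)"
  by (simp add: adj_transp_def transpose_def)

lemma inj_adj_transp [simp]: "inj (adj_transp i)"
  by (simp add: adj_transp_def)

lemma adj_transp_permutes: "1 \<le> i \<Longrightarrow> i < n \<Longrightarrow> adj_transp i permutes {1..n}"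
  by (auto simp: adj_transp_def intro!: permutes_swap_id)

lemma comp_adj_transp_twice [simp]: "(w \<circ> adj_transp i) \<circ> adj_transp i = w"
  by (simp add: comp_assoc)

lemma word_perm_simps [simp]:
  "word_perm [] = id" "word_perm (i # \<rho>) = adj_transp i \<circ> word_perm \<rho>"
  "word_perm (\<rho> @ \<sigma>) = word_perm \<rho> \<circ> word_perm \<sigma>"
proof -
  show "word_perm [] = id" "word_perm (i # \<rho>) = adj_transp i \<circ> word_perm \<rho>"
    by (simp_all add: word_perm_def)
  show "word_perm (\<rho> @ \<sigma>) = word_perm \<rho> \<circ> word_perm \<sigma>"
    by (induction \<rho>) (simp_all add: word_perm_def comp_assoc)
qed

lemma inj_word_perm: "inj (word_perm \<rho>)"
  by (induction \<rho>) (simp_all add: inj_compose del: comp_apply)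

lemma word_perm_permutes: "set \<rho> \<subseteq> {1..n - 1} \<Longrightarrow> word_perm \<rho> permutes {1..n}"
proof (induction \<rho>)
  case Nil
  then show ?case by (simp add: permutes_def)
next
  case (Cons i \<rho>)
  then have "word_perm \<rho> permutes {1..n}" "adj_transp i permutes {1..n}"
    using adj_transp_permutes[of i n] by auto
  then show ?case unfolding word_perm_simps by (rule permutes_compose)
qed

section \<open>Inversions, descents and the recursion on the last letter\<close>

definition inversions :: "nat \<Rightarrow> (nat \<Rightarrow> nat) \<Rightarrow> (nat \<times> nat) set" where
  "inversions n w = {(i, j). i \<in> {1..n} \<and> j \<in> {1..n} \<and> i < j \<and> w i > w j}"

lemma inversion_number_eq: "inversion_number n w = card (inversions n w)"
  by (simp add: inversion_number_def inversions_def)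

lemma finite_inversions [simp]: "finite (inversions n w)"
  by (rule finite_subset[of _ "{1..n} \<times> {1..n}"]) (auto simp: inversions_def)

lemma adj_transp_less:
  "a < b \<Longrightarrow> (a, b) \<noteq> (i, Suc i) \<Longrightarrow> adj_transp i a < adj_transp i b"
  by (auto simp: adj_transp_eq)

lemma adj_transp_in_range:
  "1 \<le> i \<Longrightarrow> i < n \<Longrightarrow> a \<in> {1..n} \<Longrightarrow> adj_transp i a \<in> {1..n}"
  by (auto simp: adj_transp_eq)

text \<open>The swap keeps the relative order of every pair of positions except
  \<open>(i, Suc i)\<close>, so it matches the inversions of \<open>w\<close> other than this pair
  with those of \<open>w \<circ> adj_transp i\<close>.\<close>

lemma inversions_descent:
  assumes "1 \<le> i" "i < n" "w (Suc i) < w i"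
  shows "inversions n w =
           insert (i, Suc i) (map_prod (adj_transp i) (adj_transp i) ` inversions n (w \<circ> adj_transp i))"
    (is "_ = insert _ (?f ` ?I)")
proof (intro equalityI subsetI)
  fix p assume p: "p \<in> inversions n w"
  obtain a b where ab: "p = (a, b)" by (cases p)
  show "p \<in> insert (i, Suc i) (?f ` ?I)"
  proof (cases "p = (i, Suc i)")
    case False
    then have "(adj_transp i a, adj_transp i b) \<in> ?I"
      using p assms adj_transp_less[of a b i] adj_transp_in_range[of i n]
      unfolding ab inversions_def by simp
    then have "?f (adj_transp i a, adj_transp i b) \<in> ?f ` ?I" by (rule imageI)
    then show ?thesis by (simp add: ab)
  qed simp
next
  fix p assume p: "p \<in> insert (i, Suc i) (?f ` ?I)"
  show "p \<in> inversions n w"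
  proof (cases "p = (i, Suc i)")
    case True
    then show ?thesis using assms by (simp add: inversions_def)
  next
    case False
    then obtain a b where ab: "(a, b) \<in> ?I" "p = (adj_transp i a, adj_transp i b)"
      using p by auto
    have "(a, b) \<noteq> (i, Suc i)" using ab(1) assms by (auto simp: inversions_def)
    then show ?thesis
      using ab assms adj_transp_less[of a b i] adj_transp_in_range[of i n]
      unfolding inversions_def by simp
  qed
qed

lemma inversion_number_descent:
  assumes "1 \<le> i" "i < n" "w (Suc i) < w i"
  shows "inversion_number n w = Suc (inversion_number n (w \<circ> adj_transp i))"
proof -
  have "(i, Suc i) \<notin> map_prod (adj_transp i) (adj_transp i) ` inversions n (w \<circ> adj_transp i)"
  proof
    assume "(i, Suc i) \<in> map_prod (adj_transp i) (adj_transp i) ` inversions n (w \<circ> adj_transp i)"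
    then obtain a b where "a < b" "adj_transp i a = i" "adj_transp i b = Suc i"
      by (auto simp: inversions_def)
    then have "a = Suc i" "b = i"
      by (metis adj_transp_simps(1,3), metis adj_transp_simps(2,3))
    with \<open>a < b\<close> show False by simp
  qed
  moreover have "inj_on (map_prod (adj_transp i) (adj_transp i)) (inversions n (w \<circ> adj_transp i))"
    by (rule inj_on_subset[OF prod.inj_map]) simp_all
  ultimately show ?thesis
    unfolding inversion_number_eq inversions_descent[of i n w, OF assms]
    by (simp add: card_image)
qed

lemma inversion_number_ascent:
  assumes "1 \<le> i" "i < n" "w i < w (Suc i)"
  shows "inversion_number n (w \<circ> adj_transp i) = Suc (inversion_number n w)"
  using inversion_number_descent[of i n "w \<circ> adj_transp i"] assms by simp

lemma inversion_number_id [simp]: "inversion_number n id = 0"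
  by (simp add: inversion_number_eq inversions_def not_less_iff_gr_or_eq cong: conj_cong)

text \<open>Each letter changes the number of inversions by exactly one, up or down, and
  \<open>id\<close> has none.\<close>

lemma inversion_number_word_perm_le:
  "set \<rho> \<subseteq> {1..n - 1} \<Longrightarrow> inversion_number n (word_perm \<rho>) \<le> length \<rho>"
proof (induction \<rho> rule: rev_induct)
  case (snoc i \<rho>)
  have i: "1 \<le> i" "i < n" using snoc.prems by auto
  have eq: "word_perm (\<rho> @ [i]) = word_perm \<rho> \<circ> adj_transp i" by simp
  have "word_perm \<rho> i \<noteq> word_perm \<rho> (Suc i)"
    by (simp add: inj_eq[OF inj_word_perm])
  then consider "word_perm \<rho> i < word_perm \<rho> (Suc i)" | "word_perm \<rho> (Suc i) < word_perm \<rho> i"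
    by linarith
  then show ?case
    using snoc i inversion_number_ascent[OF i, of "word_perm \<rho>"]
      inversion_number_descent[OF i, of "word_perm \<rho>"]
    unfolding eq by cases (simp_all del: comp_apply)
qed simp

lemma reduced_decomps_permutes: "\<rho> \<in> reduced_decomps n w \<Longrightarrow> w permutes {1..n}"
  unfolding reduced_decomps_def using word_perm_permutes by blast

text \<open>The recursion behind the inductions on reduced words: deleting the last letter undoes a
  descent.\<close>

lemma reduced_decomps_snoc_iff:
  "\<rho> @ [i] \<in> reduced_decomps n w \<longleftrightarrow>
     1 \<le> i \<and> i < n \<and> w (Suc i) < w i \<and> \<rho> \<in> reduced_decomps n (w \<circ> adj_transp i)"
  (is "?L \<longleftrightarrow> ?R")
proof
  assume L: ?L
  then have i: "1 \<le> i" "i < n" and len: "Suc (length \<rho>) = inversion_number n w"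
    and set: "set \<rho> \<subseteq> {1..n - 1}" and w: "w = word_perm \<rho> \<circ> adj_transp i"
    by (auto simp: reduced_decomps_def)
  have w': "w \<circ> adj_transp i = word_perm \<rho>" unfolding w by simp
  have ne: "w i \<noteq> w (Suc i)"
    unfolding w by (simp add: inj_eq[OF inj_word_perm])
  have le: "inversion_number n (w \<circ> adj_transp i) \<le> length \<rho>"
    unfolding w' using set by (rule inversion_number_word_perm_le)
  \<comment> \<open>At an ascent \<open>w \<circ> adj_transp i\<close> would have one inversion more
    than \<open>w\<close>, too many for the letters that are left.\<close>
  have desc: "w (Suc i) < w i"
    using inversion_number_ascent[OF i, of w] le len ne by (cases "w i < w (Suc i)") auto
  with i w' len set inversion_number_descent[OF i desc] show ?R
    by (auto simp: reduced_decomps_def)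
next
  assume R: ?R
  then have "word_perm (\<rho> @ [i]) = w"
    by (auto simp: reduced_decomps_def comp_assoc)
  with R inversion_number_descent[of i n w] show ?L
    by (auto simp: reduced_decomps_def)
qed

text \<open>Without descents \<open>w\<close> increases, so \<open>i \<le> w i\<close> throughout
  \<open>{1..n}\<close>, which only the identity satisfies.\<close>

lemma ex_descent:
  assumes "w permutes {1..n}" "w \<noteq> id"
  obtains (descent) i where "1 \<le> i" "i < n" "w (Suc i) < w i"
proof (rule ccontr)
  assume no: "\<not> thesis"
  have asc: "w i < w (Suc i)" if i: "1 \<le> i" "i < n" for i
  proof -
    have "\<not> w (Suc i) < w i" using no descent[OF i] by blast
    moreover have "w i \<noteq> w (Suc i)"
      by (simp add: inj_eq[OF permutes_inj[OF assms(1)]])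
    ultimately show ?thesis by simp
  qed
  have "i \<le> w i" if "i \<in> {1..n}" for i
    using that
  proof (induction i)
    case (Suc i)
    show ?case
    proof (cases "i = 0")
      case True
      then show ?thesis
        using Suc.prems permutes_in_image[OF assms(1), of "Suc i"] by auto
    next
      case False
      then show ?thesis using Suc asc[of i] by auto
    qed
  qed simp
  then have "w = id"
    using permutes_natset_ge[OF assms(1)] by blast
  with assms(2) show False by simp
qed

lemma reduced_decomps_snocI:
  "\<rho> \<in> reduced_decomps n (w \<circ> adj_transp i) \<Longrightarrow> 1 \<le> i \<Longrightarrow> i < n \<Longrightarrow> w (Suc i) < w i \<Longrightarrow>
     \<rho> @ [i] \<in> reduced_decomps n w"
  by (simp add: reduced_decomps_snoc_iff)

lemma reduced_decomps_id: "reduced_decomps n id = {[]}"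
  by (auto simp: reduced_decomps_def)

lemma inversion_number_eq_0_iff:
  assumes "w permutes {1..n}"
  shows "inversion_number n w = 0 \<longleftrightarrow> w = id"
proof
  assume 0: "inversion_number n w = 0"
  show "w = id"
  proof (rule ccontr)
    assume "w \<noteq> id"
    then obtain i where "1 \<le> i" "i < n" "w (Suc i) < w i"
      using ex_descent[OF assms] by blast
    from inversion_number_descent[OF this] 0 show False by simp
  qed
qed simp

section \<open>Orientations of 321-patterns\<close>

text \<open>The pairs of entries exchanged, in order, while the word is carried out.\<close>

primrec crossings :: "nat list \<Rightarrow> (nat \<times> nat) list" where
  "crossings [] = []"
| "crossings (i # \<rho>) = (i, Suc i) # map (map_prod (adj_transp i) (adj_transp i)) (crossings \<rho>)"

lemma crossings_append:
  "crossings (\<rho> @ \<sigma>) =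
     crossings \<rho> @ map (map_prod (word_perm \<rho>) (word_perm \<rho>)) (crossings \<sigma>)"
  by (induction \<rho>) (simp_all add: map_prod.comp prod.map_id0 del: comp_apply)

lemma crossings_snoc:
  "crossings (\<rho> @ [i]) = crossings \<rho> @ [(word_perm \<rho> i, word_perm \<rho> (Suc i))]"
  by (simp add: crossings_append)

lemma length_crossings [simp]: "length (crossings \<rho>) = length \<rho>"
  by (induction \<rho>) simp_all

text \<open>By \<open>inversions_descent\<close> the last letter contributes exactly the new
  inversion, written by its entries with the smaller first. All reduced words of \<open>w\<close>
  thus exchange the same pairs and differ only in the order.\<close>

lemma set_crossings:
  "\<rho> \<in> reduced_decomps n w \<Longrightarrow> set (crossings \<rho>) = (\<lambda>(i, j). (w j, w i)) ` inversions n w"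
proof (induction \<rho> arbitrary: w rule: rev_induct)
  case Nil
  then have "w = id" by (auto simp: reduced_decomps_def)
  then show ?case by (auto simp: inversions_def)
next
  case (snoc i \<rho>)
  then have i: "1 \<le> i" "i < n" "w (Suc i) < w i"
    and \<rho>: "\<rho> \<in> reduced_decomps n (w \<circ> adj_transp i)"
    by (simp_all add: reduced_decomps_snoc_iff)
  have "word_perm \<rho> = w \<circ> adj_transp i"
    using \<rho> by (simp add: reduced_decomps_def)
  then have "set (crossings (\<rho> @ [i])) = insert (w (Suc i), w i) (set (crossings \<rho>))"
    by (simp add: crossings_snoc)
  also have "set (crossings \<rho>) =
      (\<lambda>(i, j). (w j, w i)) ` map_prod (adj_transp i) (adj_transp i) ` inversions n (w \<circ> adj_transp i)"
    unfolding snoc.IH[OF \<rho>] image_image by (rule image_cong) auto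
  finally show ?case
    unfolding inversions_descent[of i n w, OF i] by simp
qed

lemma crossings_less:
  assumes "\<rho> \<in> reduced_decomps n w" "(x, y) \<in> set (crossings \<rho>)"
  shows "x < y"
  using assms by (auto simp: set_crossings inversions_def)

text \<open>The set of exchanges already has \<open>inversion_number n w\<close> elements, which is
  the length of the list.\<close>

lemma distinct_crossings:
  assumes "\<rho> \<in> reduced_decomps n w"
  shows "distinct (crossings \<rho>)"
proof -
  have "inj_on (\<lambda>(i, j). (w j, w i)) (inversions n w)"
    by (auto simp: inj_on_def inj_eq[OF permutes_inj[OF reduced_decomps_permutes[OF assms]]])
  then have "card (set (crossings \<rho>)) = inversion_number n w"
    by (simp add: set_crossings[OF assms] card_image inversion_number_eq)
  then show ?thesis
    using assms by (intro card_distinct) (simp add: reduced_decomps_def)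
qed

primrec before :: "'a list \<Rightarrow> 'a \<Rightarrow> 'a \<Rightarrow> bool" where
  "before [] p q \<longleftrightarrow> False"
| "before (x # xs) p q \<longleftrightarrow> x = p \<and> q \<in> set xs \<or> before xs p q"

lemma before_append:
  "before (xs @ ys) p q \<longleftrightarrow> before xs p q \<or> before ys p q \<or> p \<in> set xs \<and> q \<in> set ys"
  by (induction xs) auto

lemma before_in_set: "before xs p q \<Longrightarrow> p \<in> set xs \<and> q \<in> set xs"
  by (induction xs) auto

text \<open>In a reduced word the exchange of \<open>x\<close> and \<open>z\<close> always lies
  between the two compared here, so this one bit fixes the order of all three.\<close>

definition orient :: "nat list \<Rightarrow> (nat \<times> nat \<times> nat) set" where
  "orient \<rho> = {(x, y, z). before (crossings \<rho>) (x, y) (y, z)}"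

lemma orient_snoc:
  "orient (\<rho> @ [i]) = orient \<rho> \<union>
     {(x, y, z). (x, y) \<in> set (crossings \<rho>) \<and> (y, z) = (word_perm \<rho> i, word_perm \<rho> (Suc i))}"
  by (auto simp: orient_def crossings_snoc before_append)

text \<open>Patterns are named by their entries, smallest first, rather than by positions, to match
  \<open>crossings\<close>.\<close>

definition patterns_321 :: "nat \<Rightarrow> (nat \<Rightarrow> nat) \<Rightarrow> (nat \<times> nat \<times> nat) set" where
  "patterns_321 n w = (\<lambda>(i, j, k). (w k, w j, w i)) `
     {(i, j, k). i \<in> {1..n} \<and> j \<in> {1..n} \<and> k \<in> {1..n} \<and>
                 i < j \<and> j < k \<and> w i > w j \<and> w j > w k}"

lemma card_patterns_321:
  assumes "w permutes {1..n}"
  shows "card (patterns_321 n w) = num_321_patterns n w"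
  unfolding patterns_321_def num_321_patterns_def
proof (rule card_image, rule inj_onI)
  fix p q :: "nat \<times> nat \<times> nat"
  assume "(\<lambda>(i, j, k). (w k, w j, w i)) p = (\<lambda>(i, j, k). (w k, w j, w i)) q"
  then show "p = q"
    using permutes_inj[OF assms] by (cases p; cases q) (simp add: inj_eq)
qed

lemma finite_patterns_321: "finite (patterns_321 n w)"
proof (rule finite_subset)
  show "patterns_321 n w \<subseteq> w ` {1..n} \<times> w ` {1..n} \<times> w ` {1..n}"
    by (auto simp: patterns_321_def)
qed simp

text \<open>A pattern consists of two inversions sharing the middle entry; \<open>w\<close> being
  injective, they share its position too.\<close>

lemma mem_patterns_321_iff:
  assumes "\<rho> \<in> reduced_decomps n w"
  shows "(x, y, z) \<in> patterns_321 n w \<longleftrightarrow>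
           (x, y) \<in> set (crossings \<rho>) \<and> (y, z) \<in> set (crossings \<rho>)"
    (is "?L \<longleftrightarrow> ?R")
proof
  assume ?L
  then obtain i j k where "i \<in> {1..n}" "j \<in> {1..n}" "k \<in> {1..n}" "i < j" "j < k"
    "w i > w j" "w j > w k" "x = w k" "y = w j" "z = w i"
    by (auto simp: patterns_321_def)
  then have "(j, k) \<in> inversions n w" "(i, j) \<in> inversions n w" "x = w k" "y = w j" "z = w i"
    by (simp_all add: inversions_def)
  then show ?R
    unfolding set_crossings[OF assms] by (auto intro: rev_image_eqI)
next
  assume ?R
  then obtain i j j' k where jk: "(j, k) \<in> inversions n w" "x = w k" "y = w j"
    and ij: "(i, j') \<in> inversions n w" "y = w j'" "z = w i"
    unfolding set_crossings[OF assms] by auto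
  have "j' = j"
    using permutes_inj[OF reduced_decomps_permutes[OF assms]] ij(2) jk(3) by (simp add: inj_eq)
  then have "(i, j, k) \<in> {(i, j, k). i \<in> {1..n} \<and> j \<in> {1..n} \<and> k \<in> {1..n} \<and>
                 i < j \<and> j < k \<and> w i > w j \<and> w j > w k}"
    using ij(1) jk(1) by (simp add: inversions_def)
  then show ?L
    unfolding patterns_321_def by (rule rev_image_eqI) (simp add: jk(2,3) ij(3))
qed

lemma orient_subset_patterns:
  "\<rho> \<in> reduced_decomps n w \<Longrightarrow> orient \<rho> \<subseteq> patterns_321 n w"
  by (auto simp: orient_def mem_patterns_321_iff dest: before_in_set)

text \<open>Up to its first descent \<open>w\<close> increases, so the entry there exceeds
  everything to its left, position \<open>0\<close> included.\<close>

lemma ex_first_descent: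
  assumes "w permutes {1..n}" "w \<noteq> id"
  obtains d where "1 \<le> d" "d < n" "w (Suc d) < w d" "\<And>i. i < d \<Longrightarrow> w i < w d"
proof -
  obtain i where i: "1 \<le> i" "i < n" "w (Suc i) < w i"
    using ex_descent[OF assms] by blast
  define P where "P d \<longleftrightarrow> 1 \<le> d \<and> d < n \<and> w (Suc d) < w d" for d
  define d where "d = (LEAST d. P d)"
  have Pd: "P d" unfolding d_def by (rule LeastI[of P i]) (use i in \<open>simp add: P_def\<close>)
  have asc: "w j < w (Suc j)" if "j < d" for j
  proof (cases "j = 0")
    case True
    have "Suc 0 \<in> {1..n}" using Pd by (simp add: P_def)
    then have "w (Suc 0) \<in> {1..n}" by (rule permutes_in_image[OF assms(1), THEN iffD2])
    moreover have "w 0 = 0" by (rule permutes_not_in[OF assms(1)]) simp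
    ultimately show ?thesis using True by simp
  next
    case False
    have "\<not> P j" using that unfolding d_def by (rule not_less_Least)
    moreover have "w j \<noteq> w (Suc j)"
      by (simp add: inj_eq[OF permutes_inj[OF assms(1)]])
    ultimately show ?thesis using False that Pd unfolding P_def by linarith
  qed
  have "j < k \<Longrightarrow> w j < w k" if "k \<le> d" for j k
    using that
  proof (induction k)
    case (Suc k)
    then show ?case using asc[of k] by (cases "j = k") auto
  qed simp
  with Pd show thesis by (intro that[of d]) (auto simp: P_def)
qed

text \<open>After its last descent \<open>w\<close> increases: beyond \<open>n\<close> it is the
  identity, and at \<open>n\<close> itself \<open>w n \<le> n < w (Suc n)\<close>.\<close>

lemma ex_last_descent:
  assumes "w permutes {1..n}" "w \<noteq> id"
  obtains d where "1 \<le> d" "d < n" "w (Suc d) < w d" "\<And>i. Suc d < i \<Longrightarrow> w (Suc d) < w i"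
proof -
  obtain i where i: "1 \<le> i" "i < n" "w (Suc i) < w i"
    using ex_descent[OF assms] by blast
  define P where "P d \<longleftrightarrow> 1 \<le> d \<and> d < n \<and> w (Suc d) < w d" for d
  define d where "d = (GREATEST d. P d)"
  have Pd: "P d" unfolding d_def
    by (rule GreatestI_nat[of P i n]) (use i in \<open>simp_all add: P_def\<close>)
  have asc: "w j < w (Suc j)" if "d < j" for j
  proof (cases "j < n")
    case True
    have "\<not> P j"
    proof
      assume "P j"
      then have "j \<le> d" unfolding d_def by (rule Greatest_le_nat[of P j n]) (simp add: P_def)
      with that show False by simp
    qed
    moreover have "w j \<noteq> w (Suc j)"
      by (simp add: inj_eq[OF permutes_inj[OF assms(1)]])
    ultimately show ?thesis using that True Pd unfolding P_def by linarith
  next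
    case False
    have "w (Suc j) = Suc j" by (rule permutes_not_in[OF assms(1)]) (use False in simp)
    moreover have "w j \<le> j"
    proof (cases "j = n")
      case True
      have "n \<in> {1..n}" using Pd by (auto simp: P_def)
      then have "w n \<in> {1..n}" by (rule permutes_in_image[OF assms(1), THEN iffD2])
      then show ?thesis using True by simp
    next
      case False
      then show ?thesis using \<open>\<not> j < n\<close> permutes_not_in[OF assms(1), of j] by simp
    qed
    ultimately show ?thesis by simp
  qed
  have "Suc d < k \<Longrightarrow> w (Suc d) < w k" for k
  proof (induction k)
    case (Suc k)
    then show ?case using asc[of k] by (cases "Suc d = k") auto
  qed simp
  with Pd show thesis by (intro that[of d]) (auto simp: P_def)
qed

text \<open>Undoing the first descent at every step yields the word which orients every \<open>321\<close>-pattern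
  the same way; undoing the last descent yields the opposite one.\<close>

lemma ex_reduced_decomp_orient_full:
  "w permutes {1..n} \<Longrightarrow> \<exists>\<rho> \<in> reduced_decomps n w. patterns_321 n w \<subseteq> orient \<rho>"
proof (induction "inversion_number n w" arbitrary: w)
  case 0
  then have "w = id" using inversion_number_eq_0_iff by metis
  then have "[] \<in> reduced_decomps n w" using reduced_decomps_id by simp
  then have "patterns_321 n w = {}" using mem_patterns_321_iff[of "[]" n w] by fastforce
  with \<open>[] \<in> reduced_decomps n w\<close> show ?case by blast
next
  case (Suc l)
  have "w \<noteq> id" using Suc.hyps(2) by auto
  with Suc.prems obtain d where d: "1 \<le> d" "d < n" "w (Suc d) < w d"
    and max: "\<And>i. i < d \<Longrightarrow> w i < w d"
    using ex_first_descent by blast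
  let ?w = "w \<circ> adj_transp d"
  have "l = inversion_number n ?w"
    using Suc.hyps(2) inversion_number_descent[of d n w, OF d] by simp
  moreover have "?w permutes {1..n}"
    using permutes_compose[OF adj_transp_permutes[OF d(1,2)] Suc.prems] .
  ultimately obtain \<rho> where \<rho>: "\<rho> \<in> reduced_decomps n ?w"
    and sub: "patterns_321 n ?w \<subseteq> orient \<rho>"
    using Suc.hyps(1) by blast
  have \<rho>d: "\<rho> @ [d] \<in> reduced_decomps n w"
    using reduced_decomps_snocI[OF \<rho> d] .
  have perm: "word_perm \<rho> = ?w" using \<rho> by (simp add: reduced_decomps_def)
  have set: "set (crossings (\<rho> @ [d])) = insert (w (Suc d), w d) (set (crossings \<rho>))"
    by (simp add: crossings_snoc perm)
  have "patterns_321 n w \<subseteq> orient (\<rho> @ [d])"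
  proof
    fix t assume "t \<in> patterns_321 n w"
    moreover obtain x y z where t: "t = (x, y, z)" by (cases t)
    ultimately have that: "(x, y, z) \<in> patterns_321 n w" by simp
    have xy: "(x, y) \<in> set (crossings (\<rho> @ [d]))" and yz: "(y, z) \<in> set (crossings (\<rho> @ [d]))"
      using that unfolding mem_patterns_321_iff[OF \<rho>d] by auto
    \<comment> \<open>The last exchange is never the lower pair of a pattern: the top entry would be
      larger than \<open>w d\<close> and stand left of \<open>d\<close>.\<close>
    have "(x, y) \<noteq> (w (Suc d), w d)"
    proof
      assume eq: "(x, y) = (w (Suc d), w d)"
      from yz obtain i j where "(i, j) \<in> inversions n w" "w j = w d" "z = w i"
        unfolding set_crossings[OF \<rho>d] using eq by auto
      then have "i < d" "w d < w i"
        by (auto simp: inversions_def inj_eq[OF permutes_inj[OF Suc.prems]])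
      with max[of i] show False by simp
    qed
    then have xy: "(x, y) \<in> set (crossings \<rho>)" using xy set by auto
    show "t \<in> orient (\<rho> @ [d])"
    proof (cases "(y, z) = (w (Suc d), w d)")
      case True
      with xy show ?thesis by (simp add: t orient_snoc perm)
    next
      case False
      then have "(y, z) \<in> set (crossings \<rho>)" using yz set by auto
      with xy have "(x, y, z) \<in> patterns_321 n ?w" unfolding mem_patterns_321_iff[OF \<rho>] by simp
      with sub show ?thesis by (auto simp: t orient_snoc)
    qed
  qed
  with \<rho>d show ?case by blast
qed

lemma ex_reduced_decomp_orient_empty:
  "w permutes {1..n} \<Longrightarrow> \<exists>\<rho> \<in> reduced_decomps n w. orient \<rho> = {}"
proof (induction "inversion_number n w" arbitrary: w)
  case 0
  then have "w = id" using inversion_number_eq_0_iff by metis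
  then have "[] \<in> reduced_decomps n w" using reduced_decomps_id by simp
  moreover have "orient [] = {}" by (simp add: orient_def)
  ultimately show ?case by blast
next
  case (Suc l)
  have "w \<noteq> id" using Suc.hyps(2) by auto
  with Suc.prems obtain d where d: "1 \<le> d" "d < n" "w (Suc d) < w d"
    and min: "\<And>i. Suc d < i \<Longrightarrow> w (Suc d) < w i"
    using ex_last_descent by blast
  let ?w = "w \<circ> adj_transp d"
  have "l = inversion_number n ?w"
    using Suc.hyps(2) inversion_number_descent[of d n w, OF d] by simp
  moreover have "?w permutes {1..n}"
    using permutes_compose[OF adj_transp_permutes[OF d(1,2)] Suc.prems] .
  ultimately obtain \<rho> where \<rho>: "\<rho> \<in> reduced_decomps n ?w" and empty: "orient \<rho> = {}"
    using Suc.hyps(1) by blast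
  have \<rho>d: "\<rho> @ [d] \<in> reduced_decomps n w"
    using reduced_decomps_snocI[OF \<rho> d] .
  have perm: "word_perm \<rho> = ?w" using \<rho> by (simp add: reduced_decomps_def)
  \<comment> \<open>The last exchange is never the upper pair of a pattern, because no entry right
    of \<open>Suc d\<close> is smaller than \<open>w (Suc d)\<close>. Hence it adds no
    triple.\<close>
  have "(x, w (Suc d)) \<notin> set (crossings \<rho>)" for x
  proof
    assume "(x, w (Suc d)) \<in> set (crossings \<rho>)"
    then have "(x, w (Suc d)) \<in> set (crossings (\<rho> @ [d]))" by (simp add: crossings_snoc)
    then obtain i j where "(i, j) \<in> inversions n w" "w i = w (Suc d)" "x = w j"
      unfolding set_crossings[OF \<rho>d] by auto
    then have "Suc d < j" "w j < w (Suc d)"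
      by (auto simp: inversions_def inj_eq[OF permutes_inj[OF Suc.prems]])
    with min[of j] show False by simp
  qed
  then have "orient (\<rho> @ [d]) = {}" using empty by (auto simp: orient_snoc perm)
  with \<rho>d show ?case by blast
qed

section \<open>Braid moves and the connectedness of the reduced words\<close>

definition braid_move :: "nat list \<Rightarrow> nat list \<Rightarrow> bool" where
  "braid_move \<rho> \<sigma> \<longleftrightarrow> short_braid \<rho> \<sigma> \<or> (\<exists>k. long_braid_at k \<rho> \<sigma>)"

lemma short_braid_append: "short_braid \<rho> \<sigma> \<Longrightarrow> short_braid (\<rho> @ \<tau>) (\<sigma> @ \<tau>)"
  unfolding short_braid_def by (metis append.assoc)

lemma long_braid_at_append: "long_braid_at k \<rho> \<sigma> \<Longrightarrow> long_braid_at k (\<rho> @ \<tau>) (\<sigma> @ \<tau>)"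
  unfolding long_braid_at_def by (metis append.assoc)

lemma braid_moves_append: "braid_move\<^sup>*\<^sup>* \<rho> \<sigma> \<Longrightarrow> braid_move\<^sup>*\<^sup>* (\<rho> @ \<tau>) (\<sigma> @ \<tau>)"
proof (induction rule: rtranclp_induct)
  case (step \<sigma> \<sigma>')
  have "braid_move (\<sigma> @ \<tau>) (\<sigma>' @ \<tau>)"
    using step.hyps(2) unfolding braid_move_def
    by (metis short_braid_append long_braid_at_append)
  with step.IH show ?case by (rule rtranclp.rtrancl_into_rtrancl)
qed simp

lemma braid_move_short: "i + 2 \<le> j \<or> j + 2 \<le> i \<Longrightarrow> braid_move (\<tau> @ [i, j]) (\<tau> @ [j, i])"
  unfolding braid_move_def short_braid_def by (intro disjI1 exI[of _ \<tau>] exI[of _ "[]"]) auto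

lemma braid_move_long: "braid_move (\<tau> @ [i, Suc i, i]) (\<tau> @ [Suc i, i, Suc i])"
  "braid_move (\<tau> @ [Suc i, i, Suc i]) (\<tau> @ [i, Suc i, i])"
  unfolding braid_move_def long_braid_at_def
  by (intro disjI2 exI[of _ "length \<tau>"] exI[of _ \<tau>] exI[of _ "[]"] exI[of _ i], simp)+

lemma braid_moves_sym: "braid_move\<^sup>*\<^sup>* \<rho> \<sigma> \<Longrightarrow> braid_move\<^sup>*\<^sup>* \<sigma> \<rho>"
proof (rule sympD[OF symp_rtranclp])
  have "long_braid_at k \<sigma> \<rho>" if "long_braid_at k \<rho> \<sigma>" for k \<rho> \<sigma>
    using that unfolding long_braid_at_def by blast
  then show "symp braid_move"
    unfolding symp_def braid_move_def using sym_short_braid by blast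
qed

lemma adj_transp_commute:
  "i + 2 \<le> j \<or> j + 2 \<le> i \<Longrightarrow> adj_transp i \<circ> adj_transp j = adj_transp j \<circ> adj_transp i"
  by (auto simp: fun_eq_iff adj_transp_eq)

lemma adj_transp_braid:
  "adj_transp i \<circ> adj_transp (Suc i) \<circ> adj_transp i =
   adj_transp (Suc i) \<circ> adj_transp i \<circ> adj_transp (Suc i)"
  by (auto simp: fun_eq_iff adj_transp_eq)

lemma reduced_decomps_nonempty:
  "w permutes {1..n} \<Longrightarrow> \<exists>\<rho>. \<rho> \<in> reduced_decomps n w"
  using ex_reduced_decomp_orient_empty by blast

text \<open>Matsumoto's theorem for the symmetric group.\<close>

lemma braid_connected:
  "\<rho> \<in> reduced_decomps n w \<Longrightarrow> \<sigma> \<in> reduced_decomps n w \<Longrightarrow> braid_move\<^sup>*\<^sup>* \<rho> \<sigma>"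
proof (induction "length \<rho>" arbitrary: \<rho> \<sigma> w)
  case 0
  have "length \<sigma> = length \<rho>" using 0(2,3) by (simp add: reduced_decomps_def)
  with 0 show ?case by simp
next
  case (Suc l)
  obtain \<rho>' i where \<rho>: "\<rho> = \<rho>' @ [i]" using Suc.hyps(2) by (cases \<rho> rule: rev_cases) auto
  have "length \<sigma> = Suc l" using Suc.hyps(2) Suc.prems by (simp add: reduced_decomps_def)
  then obtain \<sigma>' j where \<sigma>: "\<sigma> = \<sigma>' @ [j]" by (cases \<sigma> rule: rev_cases) auto
  \<comment> \<open>Words with the same last letter are joined by removing it; the other cases are
    reduced to this one.\<close>
  have IH: "braid_move\<^sup>*\<^sup>* (\<alpha> @ [k]) (\<beta> @ [k])"
    if "\<alpha> @ [k] \<in> reduced_decomps n w" "\<beta> @ [k] \<in> reduced_decomps n w" for \<alpha> \<beta> k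
  proof (rule braid_moves_append, rule Suc.hyps(1))
    show "\<alpha> \<in> reduced_decomps n (w \<circ> adj_transp k)" "\<beta> \<in> reduced_decomps n (w \<circ> adj_transp k)"
      using that by (simp_all add: reduced_decomps_snoc_iff)
    show "l = length \<alpha>"
      using that(1) Suc.hyps(2) Suc.prems(1) by (simp add: reduced_decomps_def)
  qed
  have perm: "w permutes {1..n}" by (rule reduced_decomps_permutes[OF Suc.prems(1)])
  \<comment> \<open>Descents at \<open>k\<close> and \<open>Suc k\<close> make three consecutive
    entries decreasing, so \<open>w\<close> also has reduced words ending in the two sides of a long
    braid move.\<close>
  have adjacent: "braid_move\<^sup>*\<^sup>* (\<alpha> @ [k]) (\<beta> @ [Suc k])"
    if \<alpha>: "\<alpha> @ [k] \<in> reduced_decomps n w" and \<beta>: "\<beta> @ [Suc k] \<in> reduced_decomps n w" for \<alpha> \<beta> k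
  proof -
    have k: "1 \<le> k" "k < n" "w (Suc k) < w k" "Suc k < n" "w (Suc (Suc k)) < w (Suc k)"
      using \<alpha> \<beta> by (simp_all add: reduced_decomps_snoc_iff)
    let ?v = "w \<circ> adj_transp k \<circ> adj_transp (Suc k) \<circ> adj_transp k"
    have v: "?v = w \<circ> adj_transp (Suc k) \<circ> adj_transp k \<circ> adj_transp (Suc k)"
      using adj_transp_braid[of k] by (simp add: comp_assoc)
    have "?v permutes {1..n}"
      using k by (intro permutes_compose perm adj_transp_permutes) auto
    then obtain \<tau> where \<tau>: "\<tau> \<in> reduced_decomps n ?v" using reduced_decomps_nonempty by blast
    have "((\<tau> @ [k]) @ [Suc k]) @ [k] \<in> reduced_decomps n w"
      unfolding reduced_decomps_snoc_iff using \<tau> k by (simp add: adj_transp_eq)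
    moreover have "((\<tau> @ [Suc k]) @ [k]) @ [Suc k] \<in> reduced_decomps n w"
      unfolding reduced_decomps_snoc_iff using \<tau>[unfolded v] k by (simp add: adj_transp_eq)
    ultimately have "braid_move\<^sup>*\<^sup>* (\<alpha> @ [k]) (((\<tau> @ [k]) @ [Suc k]) @ [k])"
      "braid_move\<^sup>*\<^sup>* (((\<tau> @ [Suc k]) @ [k]) @ [Suc k]) (\<beta> @ [Suc k])"
      using IH \<alpha> \<beta> by blast+
    moreover have "braid_move (((\<tau> @ [k]) @ [Suc k]) @ [k]) (((\<tau> @ [Suc k]) @ [k]) @ [Suc k])"
      using braid_move_long(1)[of \<tau> k] by simp
    ultimately show ?thesis by (meson rtranclp.rtrancl_into_rtrancl rtranclp_trans)
  qed
  \<comment> \<open>The two descents do not interfere, so both can be undone in either order; the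
    two resulting words differ by a short braid move.\<close>
  have far: "braid_move\<^sup>*\<^sup>* \<rho> \<sigma>" if ij: "i + 2 \<le> j \<or> j + 2 \<le> i"
  proof -
    have i: "1 \<le> i" "i < n" "w (Suc i) < w i" "1 \<le> j" "j < n" "w (Suc j) < w j"
      using Suc.prems by (simp_all add: reduced_decomps_snoc_iff \<rho> \<sigma>)
    let ?v = "w \<circ> adj_transp i \<circ> adj_transp j"
    have v: "?v = w \<circ> adj_transp j \<circ> adj_transp i"
      using adj_transp_commute[OF ij] by (simp add: comp_assoc)
    have "?v permutes {1..n}"
      using i by (intro permutes_compose perm adj_transp_permutes) auto
    then obtain \<tau> where \<tau>: "\<tau> \<in> reduced_decomps n ?v" using reduced_decomps_nonempty by blast
    have "\<tau> @ [j] \<in> reduced_decomps n (w \<circ> adj_transp i)"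
      using i ij by (intro reduced_decomps_snocI[OF \<tau>]) (auto simp: adj_transp_eq)
    then have "(\<tau> @ [j]) @ [i] \<in> reduced_decomps n w"
      by (rule reduced_decomps_snocI[OF _ i(1-3)])
    then have "braid_move\<^sup>*\<^sup>* \<rho> ((\<tau> @ [j]) @ [i])"
      using IH Suc.prems(1) unfolding \<rho> by blast
    moreover have "\<tau> @ [i] \<in> reduced_decomps n (w \<circ> adj_transp j)"
      using i ij by (intro reduced_decomps_snocI[OF \<tau>[unfolded v]]) (auto simp: adj_transp_eq)
    then have "(\<tau> @ [i]) @ [j] \<in> reduced_decomps n w"
      by (rule reduced_decomps_snocI[OF _ i(4-6)])
    then have "braid_move\<^sup>*\<^sup>* ((\<tau> @ [i]) @ [j]) \<sigma>"
      using IH Suc.prems(2) unfolding \<sigma> by blast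
    moreover have "braid_move ((\<tau> @ [j]) @ [i]) ((\<tau> @ [i]) @ [j])"
      using braid_move_short[of j i \<tau>] ij by auto
    ultimately show ?thesis by (meson rtranclp.rtrancl_into_rtrancl rtranclp_trans)
  qed
  consider "i = j" | "j = Suc i" | "i = Suc j" | "i + 2 \<le> j \<or> j + 2 \<le> i" by linarith
  then show ?case
  proof cases
    case 1
    then show ?thesis using IH Suc.prems unfolding \<rho> \<sigma> by blast
  next
    case 2
    then show ?thesis using adjacent Suc.prems unfolding \<rho> \<sigma> by blast
  next
    case 3
    then show ?thesis using adjacent Suc.prems braid_moves_sym unfolding \<rho> \<sigma> by blast
  qed (rule far)
qed

section \<open>The effect of braid moves on orientations\<close>

lemma short_braid_reduced:
  assumes "short_braid \<rho> \<sigma>" "\<rho> \<in> reduced_decomps n w"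
  shows "\<sigma> \<in> reduced_decomps n w"
proof -
  obtain us vs i j where ij: "i + 2 \<le> j \<or> j + 2 \<le> i"
    and eq: "\<rho> = us @ [i, j] @ vs" "\<sigma> = us @ [j, i] @ vs"
    using assms(1) unfolding short_braid_def by blast
  have "word_perm \<sigma> = word_perm us \<circ> (adj_transp j \<circ> adj_transp i) \<circ> word_perm vs"
    unfolding eq by (simp add: comp_assoc)
  also have "\<dots> = word_perm \<rho>"
    unfolding eq adj_transp_commute[OF ij, symmetric] by (simp add: comp_assoc)
  finally show ?thesis using assms(2) by (auto simp: reduced_decomps_def eq)
qed

text \<open>The two exchanged pairs share no entry, so \<open>orient\<close> never compares them,
  and all other exchanges keep their places.\<close>

lemma short_braid_orient:
  assumes "short_braid \<rho> \<sigma>"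
  shows "orient \<sigma> = orient \<rho>"
proof -
  obtain us vs i j where ij: "i + 2 \<le> j \<or> j + 2 \<le> i"
    and eq: "\<rho> = us @ [i, j] @ vs" "\<sigma> = us @ [j, i] @ vs"
    using assms unfolding short_braid_def by blast
  let ?g = "word_perm us"
  have g: "?g a = ?g b \<longleftrightarrow> a = b" for a b by (rule inj_eq[OF inj_word_perm])
  define A where "A = (?g i, ?g (Suc i))"
  define B where "B = (?g j, ?g (Suc j))"
  define C where "C = map (map_prod ?g ?g)
    (map (map_prod (adj_transp i) (adj_transp i)) (map (map_prod (adj_transp j) (adj_transp j)) (crossings vs)))"
  have "map_prod (adj_transp j) (adj_transp j) \<circ> map_prod (adj_transp i) (adj_transp i) =
        map_prod (adj_transp i) (adj_transp i) \<circ> map_prod (adj_transp j) (adj_transp j)"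
    by (simp add: map_prod.comp adj_transp_commute[OF ij])
  then have "crossings \<rho> = crossings us @ [A, B] @ C" "crossings \<sigma> = crossings us @ [B, A] @ C"
    using ij by (auto simp: eq crossings_append A_def B_def C_def adj_transp_other comp_assoc[symmetric])
  moreover have "snd A \<noteq> fst B" "snd B \<noteq> fst A"
    using ij by (auto simp: A_def B_def g)
  ultimately show ?thesis
    by (auto simp: orient_def before_append)
qed

abbreviation symdiff :: "'a set \<Rightarrow> 'a set \<Rightarrow> 'a set" where
  "symdiff A B \<equiv> (A - B) \<union> (B - A)"

text \<open>At a place of a long braid move the three exchanges are \<open>(a, b), (a, c), (b, c)\<close>, in this or
  the reverse order, and the triple is \<open>(a, b, c)\<close>.\<close>

definition place_triple :: "nat list \<Rightarrow> nat \<Rightarrow> nat \<times> nat \<times> nat" where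
  "place_triple \<rho> k =
     (let p = crossings \<rho> ! k; q = crossings \<rho> ! Suc k
      in (fst q, if fst p = fst q then snd p else fst p, snd q))"

text \<open>The braid relation leaves all exchanges outside the factor alone. The conclusions cover
  both words, so the opposite move only needs \<open>\<rho>\<close> and \<open>\<sigma>\<close>
  interchanged.\<close>

lemma long_braid_effect_aux:
  assumes eq: "\<rho> = us @ [i, Suc i, i] @ vs" "\<sigma> = us @ [Suc i, i, Suc i] @ vs"
    and k: "k = length us"
  obtains A B C xs ys a b c where
    "crossings \<rho> = xs @ [A, B, C] @ ys" "crossings \<sigma> = xs @ [C, B, A] @ ys" "length xs = k"
    "A = (a, b)" "B = (a, c)" "C = (b, c)" "a \<noteq> b" "b \<noteq> c" "a \<noteq> c"
    "place_triple \<rho> k = (a, b, c)" "place_triple \<sigma> k = (a, b, c)"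
    "word_perm \<sigma> = word_perm \<rho>"
proof -
  let ?g = "word_perm us"
  let ?f = "\<lambda>i. map_prod (adj_transp i) (adj_transp i)"
  have g: "?g a = ?g b \<longleftrightarrow> a = b" for a b by (rule inj_eq[OF inj_word_perm])
  define a b c where "a = ?g i" and "b = ?g (Suc i)" and "c = ?g (Suc (Suc i))"
  define ys where "ys = map (map_prod ?g ?g \<circ> (?f i \<circ> ?f (Suc i) \<circ> ?f i)) (crossings vs)"
  have f: "?f i \<circ> ?f (Suc i) \<circ> ?f i = ?f (Suc i) \<circ> ?f i \<circ> ?f (Suc i)"
    by (simp add: map_prod.comp adj_transp_braid)
  have 1: "crossings \<rho> = crossings us @ [(a, b), (a, c), (b, c)] @ ys"
    unfolding eq ys_def by (simp add: crossings_append a_def b_def c_def adj_transp_eq comp_assoc)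
  have 2: "crossings \<sigma> = crossings us @ [(b, c), (a, c), (a, b)] @ ys"
    unfolding eq ys_def f by (simp add: crossings_append a_def b_def c_def adj_transp_eq comp_assoc)
  have ne: "a \<noteq> b" "b \<noteq> c" "a \<noteq> c" by (simp_all add: a_def b_def c_def g)
  have "place_triple \<rho> k = (a, b, c)" "place_triple \<sigma> k = (a, b, c)"
    using ne by (simp_all add: place_triple_def 1 2 k nth_append)
  moreover have "word_perm \<sigma> = ?g \<circ> (adj_transp (Suc i) \<circ> adj_transp i \<circ> adj_transp (Suc i)) \<circ> word_perm vs"
    unfolding eq by (simp add: comp_assoc)
  then have "word_perm \<sigma> = word_perm \<rho>"
    unfolding adj_transp_braid[symmetric] eq by (simp add: comp_assoc)
  ultimately show thesis
    using that[OF 1 2] ne k by simp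
qed

text \<open>Of the three reversed exchanges only \<open>(a, b)\<close> and \<open>(b, c)\<close> are
  of the form compared by \<open>orient\<close>, so a single triple is toggled. The third claim
  serves to combine several moves, the fourth to recover a place from its triple.\<close>

lemma long_braid_effect:
  assumes lb: "long_braid_at k \<rho> \<sigma>" and \<rho>: "\<rho> \<in> reduced_decomps n w"
  shows "\<sigma> \<in> reduced_decomps n w" (is ?red)
    and "orient \<sigma> = symdiff (orient \<rho>) {place_triple \<rho> k}" (is ?orient)
    and "m \<notin> {k, k + 1, k + 2} \<Longrightarrow> \<sigma> ! m = \<rho> ! m \<and> crossings \<sigma> ! m = crossings \<rho> ! m"
      (is "_ \<Longrightarrow> ?nth")
    and "\<exists>a b c. place_triple \<rho> k = (a, b, c) \<and> crossings \<rho> ! Suc k = (a, c)" (is ?triple)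
proof -
  obtain us vs i where us: "k = length us" and
    "\<rho> = us @ [i, Suc i, i] @ vs \<and> \<sigma> = us @ [Suc i, i, Suc i] @ vs \<or>
     \<rho> = us @ [Suc i, i, Suc i] @ vs \<and> \<sigma> = us @ [i, Suc i, i] @ vs"
    using lb unfolding long_braid_at_def by auto
  then consider (up) "\<rho> = us @ [i, Suc i, i] @ vs" "\<sigma> = us @ [Suc i, i, Suc i] @ vs"
    | (down) "\<rho> = us @ [Suc i, i, Suc i] @ vs" "\<sigma> = us @ [i, Suc i, i] @ vs" by blast
  then have "?red \<and> ?orient \<and> (m \<notin> {k, k + 1, k + 2} \<longrightarrow> ?nth) \<and> ?triple"
  proof cases
    case up
    from long_braid_effect_aux[OF up us] obtain A B C xs ys a b c where *:
      "crossings \<rho> = xs @ [A, B, C] @ ys" "crossings \<sigma> = xs @ [C, B, A] @ ys" "length xs = k"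
      "A = (a, b)" "B = (a, c)" "C = (b, c)" "a \<noteq> b" "b \<noteq> c" "a \<noteq> c"
      "place_triple \<rho> k = (a, b, c)" "word_perm \<sigma> = word_perm \<rho>" .
    have red: ?red
      using \<rho> up *(11) by (auto simp: reduced_decomps_def)
    \<comment> \<open>Distinctness keeps \<open>(a, b)\<close> and \<open>(b, c)\<close> from
      occurring elsewhere, so that reversing them really toggles the triple.\<close>
    have "distinct (xs @ [A, B, C] @ ys)" using distinct_crossings[OF \<rho>] by (simp add: *)
    then have ?orient
      unfolding orient_def *(1,2,10) using *(4-9)
      by (auto simp: before_append dest: before_in_set)
    moreover have "m \<notin> {k, k + 1, k + 2} \<longrightarrow> ?nth"
      using *(1-3) us by (auto simp: up nth_append nth_Cons' )
    moreover have ?triple using * by (simp add: nth_append)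
    ultimately show ?thesis using red by blast
  next
    case down
    from long_braid_effect_aux[OF down(2,1) us] obtain A B C xs ys a b c where *:
      "crossings \<sigma> = xs @ [A, B, C] @ ys" "crossings \<rho> = xs @ [C, B, A] @ ys" "length xs = k"
      "A = (a, b)" "B = (a, c)" "C = (b, c)" "a \<noteq> b" "b \<noteq> c" "a \<noteq> c"
      "place_triple \<rho> k = (a, b, c)" "word_perm \<rho> = word_perm \<sigma>" .
    have red: ?red
      using \<rho> down *(11) by (auto simp: reduced_decomps_def)
    have "distinct (xs @ [C, B, A] @ ys)" using distinct_crossings[OF \<rho>] by (simp add: *)
    then have ?orient
      unfolding orient_def *(1,2,10) using *(4-9)
      by (auto simp: before_append dest: before_in_set)
    moreover have "m \<notin> {k, k + 1, k + 2} \<longrightarrow> ?nth"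
      using *(1-3) us by (auto simp: down nth_append nth_Cons')
    moreover have ?triple using * by (simp add: nth_append)
    ultimately show ?thesis using red by blast
  qed
  then show ?red ?orient "m \<notin> {k, k + 1, k + 2} \<Longrightarrow> ?nth" ?triple by blast+
qed

text \<open>Only three letters decide whether a move applies, so it stays applicable after moves at
  disjoint places.\<close>

lemma long_braid_at_iff:
  "(\<exists>\<sigma>. long_braid_at k \<rho> \<sigma>) \<longleftrightarrow> k + 2 < length \<rho> \<and> \<rho> ! k = \<rho> ! (k + 2) \<and>
     (\<rho> ! (k + 1) = Suc (\<rho> ! k) \<or> \<rho> ! k = Suc (\<rho> ! (k + 1)))"
  (is "?L \<longleftrightarrow> ?R")
proof
  assume ?L
  then show ?R by (auto simp: long_braid_at_def nth_append)
next
  assume R: ?R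
  have "drop k \<rho> = [\<rho> ! k, \<rho> ! (k + 1), \<rho> ! (k + 2)] @ drop (k + 3) \<rho>"
    using conjunct1[OF R] by (simp add: Cons_nth_drop_Suc numeral_eq_Suc)
  then have "\<rho> = take k \<rho> @ [\<rho> ! k, \<rho> ! (k + 1), \<rho> ! (k + 2)] @ drop (k + 3) \<rho>"
    by (metis append_take_drop_id)
  moreover have "length (take k \<rho>) = k" using R by simp
  ultimately show ?L
    using R unfolding long_braid_at_def by (metis Suc_eq_plus1)
qed

section \<open>Cubes of independent long braid moves\<close>

definition places :: "nat list \<Rightarrow> nat set" where
  "places \<rho> = {k. \<exists>\<sigma>. long_braid_at k \<rho> \<sigma>}"

lemma finite_places: "finite (places \<rho>)"
  by (rule finite_subset[of _ "{..<length \<rho>}"]) (auto simp: places_def long_braid_at_iff)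

text \<open>Two consecutive places force a factor \<open>i, j, i, j\<close> with adjacent
  \<open>i\<close> and \<open>j\<close>, which is not reduced.\<close>

lemma places_not_consecutive:
  assumes \<rho>: "\<rho> \<in> reduced_decomps n w" and k: "k \<in> places \<rho>"
  shows "Suc k \<notin> places \<rho>"
proof
  assume "Suc k \<in> places \<rho>"
  with k have len: "k + 3 < length \<rho>" and eq: "\<rho> ! (k + 2) = \<rho> ! k" "\<rho> ! (k + 3) = \<rho> ! (k + 1)"
    and adj: "\<rho> ! (k + 1) = Suc (\<rho> ! k) \<or> \<rho> ! k = Suc (\<rho> ! (k + 1))"
    by (auto simp: places_def long_braid_at_iff numeral_eq_Suc)
  define i j where "i = \<rho> ! k" and "j = \<rho> ! (k + 1)"
  have "drop k \<rho> = \<rho> ! k # \<rho> ! (k + 1) # \<rho> ! (k + 2) # \<rho> ! (k + 3) # drop (k + 4) \<rho>"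
    using len by (simp add: Cons_nth_drop_Suc numeral_eq_Suc)
  then have "drop k \<rho> = [i, j, i, j] @ drop (k + 4) \<rho>"
    unfolding eq i_def j_def by simp
  then have "\<rho> = take k \<rho> @ [i, j, i, j] @ drop (k + 4) \<rho>"
    by (metis append_take_drop_id)
  then have eq: "crossings \<rho> = crossings (take k \<rho> @ [i, j, i, j] @ drop (k + 4) \<rho>)" by simp
  let ?g = "word_perm (take k \<rho>)"
  have "j = Suc i \<or> i = Suc j" using adj by (simp add: i_def j_def)
  \<comment> \<open>The first and the fourth letter exchange the same two entries in opposite
    directions.\<close>
  then have "(i, Suc i) \<in> set (crossings [i, j, i, j])" "(Suc i, i) \<in> set (crossings [i, j, i, j])"
    by (auto simp: adj_transp_eq)
  then have "map_prod ?g ?g (i, Suc i) \<in> set (crossings \<rho>)" "map_prod ?g ?g (Suc i, i) \<in> set (crossings \<rho>)"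
    unfolding eq crossings_append map_append set_append set_map by blast+
  then show False
    using crossings_less[OF \<rho>, of "?g i" "?g (Suc i)"] crossings_less[OF \<rho>, of "?g (Suc i)" "?g i"]
    by simp
qed

text \<open>Greedy choice: take the least element \<open>k\<close>. As \<open>Suc k\<close> is
  absent, only \<open>k + 2\<close> is too close, so at most two elements are lost for each one
  chosen.\<close>

lemma separated_subset:
  fixes P :: "nat set"
  assumes "finite P" "\<And>k. k \<in> P \<Longrightarrow> Suc k \<notin> P"
  shows "\<exists>K \<subseteq> P. card P \<le> 2 * card K \<and> (\<forall>k \<in> K. \<forall>l \<in> K. k < l \<longrightarrow> k + 3 \<le> l)"
  using assms
proof (induction "card P" arbitrary: P rule: less_induct)
  case less
  show ?case
  proof (cases "P = {}")
    case False
    define k where "k = Min P"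
    have k: "k \<in> P" "\<And>l. l \<in> P \<Longrightarrow> k \<le> l" using less.prems(1) False by (simp_all add: k_def)
    let ?P = "P - {k, k + 2}"
    have "card ?P < card P" using k(1) less.prems(1) by (intro psubset_card_mono) auto
    then obtain K where K: "K \<subseteq> ?P" "card ?P \<le> 2 * card K"
      "\<forall>k \<in> K. \<forall>l \<in> K. k < l \<longrightarrow> k + 3 \<le> l"
      using less.hyps[of ?P] less.prems by auto
    have far: "k + 3 \<le> l" if "l \<in> K" for l
    proof -
      have "l \<in> P" "l \<noteq> k" "l \<noteq> k + 2" using that K(1) by auto
      moreover have "l \<noteq> Suc k" using less.prems(2)[OF k(1)] \<open>l \<in> P\<close> by auto
      ultimately show ?thesis using k(2)[of l] by linarith
    qed
    have fin: "finite K" using K(1) less.prems(1) finite_subset by blast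
    have "k \<notin> K" using K(1) by auto
    have "card P \<le> card ({k, k + 2} \<union> ?P)"
      using less.prems(1) by (intro card_mono) auto
    also have "\<dots> \<le> card {k, k + 2} + card ?P" by (rule card_Un_le)
    also have "\<dots> \<le> 2 * card (insert k K)"
      using K(2) fin \<open>k \<notin> K\<close> by simp
    finally have "card P \<le> 2 * card (insert k K)" .
    moreover have "\<forall>x \<in> insert k K. \<forall>y \<in> insert k K. x < y \<longrightarrow> x + 3 \<le> y"
      using K(3) far by fastforce
    moreover have "insert k K \<subseteq> P" using K(1) k(1) by auto
    ultimately show ?thesis by blast
  qed auto
qed

text \<open>The outer entries of the triple are the exchange at \<open>Suc k\<close>, and no
  exchange is repeated.\<close>

lemma place_triple_inj:
  assumes \<rho>: "\<rho> \<in> reduced_decomps n w"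
  shows "inj_on (place_triple \<rho>) (places \<rho>)"
proof (rule inj_onI)
  fix k l assume kl: "k \<in> places \<rho>" "l \<in> places \<rho>" "place_triple \<rho> k = place_triple \<rho> l"
  have len: "Suc k < length (crossings \<rho>)" "Suc l < length (crossings \<rho>)"
    using kl(1,2) by (auto simp: places_def long_braid_at_iff)
  have "\<exists>a b c. place_triple \<rho> m = (a, b, c) \<and> crossings \<rho> ! Suc m = (a, c)" if "m \<in> places \<rho>" for m
    using that long_braid_effect(4)[OF _ \<rho>] unfolding places_def by blast
  from this[OF kl(1)] this[OF kl(2)] kl(3)
  have "crossings \<rho> ! Suc k = crossings \<rho> ! Suc l" by auto
  then show "k = l"
    using nth_eq_iff_index_eq[OF distinct_crossings[OF \<rho>] len] by simp
qed

lemma symdiff_insert: "t \<notin> B \<Longrightarrow> symdiff (symdiff A B) {t} = symdiff A (insert t B)"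
  by blast

text \<open>Places three apart use disjoint letters, so the moves can be made one after another. The
  last conjunct carries the induction: it keeps the next move applicable and its triple
  unchanged.\<close>

lemma braid_cube:
  assumes \<rho>: "\<rho> \<in> reduced_decomps n w" and K: "K \<subseteq> places \<rho>" "finite S" "S \<subseteq> K"
    and sep: "\<forall>k \<in> K. \<forall>l \<in> K. k < l \<longrightarrow> k + 3 \<le> l"
  shows "\<exists>\<sigma> \<in> reduced_decomps n w. orient \<sigma> = symdiff (orient \<rho>) (place_triple \<rho> ` S) \<and>
           (\<forall>m. (\<forall>k \<in> S. m \<notin> {k, k + 1, k + 2}) \<longrightarrow>
              \<sigma> ! m = \<rho> ! m \<and> crossings \<sigma> ! m = crossings \<rho> ! m)"
  using K(2,3)
proof (induction S rule: finite_induct)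
  case empty
  then show ?case using \<rho> by auto
next
  case (insert k S)
  then obtain \<sigma> where \<sigma>: "\<sigma> \<in> reduced_decomps n w"
    and orient: "orient \<sigma> = symdiff (orient \<rho>) (place_triple \<rho> ` S)"
    and nth: "\<And>m. (\<forall>k \<in> S. m \<notin> {k, k + 1, k + 2}) \<Longrightarrow>
              \<sigma> ! m = \<rho> ! m \<and> crossings \<sigma> ! m = crossings \<rho> ! m" by auto
  have kP: "k \<in> places \<rho>" using insert.prems K(1) by blast
  have apart: "m \<notin> {l, l + 1, l + 2}" if "l \<in> S" "m \<in> {k, k + 1, k + 2}" for l m
  proof -
    have "l \<noteq> k" "l \<in> K" "k \<in> K" using that insert.hyps insert.prems by auto
    then have "k + 3 \<le> l \<or> l + 3 \<le> k" using sep by (meson linorder_neqE_nat)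
    then show ?thesis using that(2) by auto
  qed
  have same: "\<sigma> ! m = \<rho> ! m" "crossings \<sigma> ! m = crossings \<rho> ! m" if "m \<in> {k, k + 1, k + 2}" for m
    using nth[of m] apart that by blast+
  have len: "length \<sigma> = length \<rho>" using \<sigma> \<rho> by (simp add: reduced_decomps_def)
  have segment: "\<sigma> ! k = \<rho> ! k" "\<sigma> ! (k + 1) = \<rho> ! (k + 1)" "\<sigma> ! (k + 2) = \<rho> ! (k + 2)"
    by (rule same(1), simp)+
  \<comment> \<open>The three letters at \<open>k\<close> are still those of
    \<open>\<rho>\<close>.\<close>
  have "\<exists>\<tau>. long_braid_at k \<sigma> \<tau>"
    using kP unfolding places_def long_braid_at_iff mem_Collect_eq len segment .
  then obtain \<tau> where \<tau>: "long_braid_at k \<sigma> \<tau>" by blast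
  have triple: "place_triple \<sigma> k = place_triple \<rho> k"
    using same(2)[of k] same(2)[of "k + 1"] by (simp add: place_triple_def)
  have "place_triple \<rho> k \<notin> place_triple \<rho> ` S"
  proof
    assume "place_triple \<rho> k \<in> place_triple \<rho> ` S"
    then obtain l where "l \<in> S" "place_triple \<rho> k = place_triple \<rho> l" by blast
    moreover from this have "l \<in> places \<rho>" using insert.prems K(1) by blast
    ultimately show False
      using inj_onD[OF place_triple_inj[OF \<rho>] _ kP] insert.hyps(2) by blast
  qed
  then have "orient \<tau> = symdiff (orient \<rho>) (place_triple \<rho> ` insert k S)"
    unfolding long_braid_effect(2)[OF \<tau> \<sigma>] triple orient image_insert
    by (rule symdiff_insert)
  moreover have "\<tau> ! m = \<rho> ! m \<and> crossings \<tau> ! m = crossings \<rho> ! m"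
    if "\<forall>l \<in> insert k S. m \<notin> {l, l + 1, l + 2}" for m
    using long_braid_effect(3)[OF \<tau> \<sigma>, of m] nth[of m] that by simp
  ultimately show ?case using long_braid_effect(1)[OF \<tau> \<sigma>] by blast
qed

section \<open>Growing a set of orientations along braid moves\<close>

lemma braid_move_orient:
  assumes "braid_move \<rho> \<sigma>" "\<rho> \<in> reduced_decomps n w"
  shows "\<sigma> \<in> reduced_decomps n w" "\<exists>t. symdiff (orient \<sigma>) (orient \<rho>) \<subseteq> {t}"
proof -
  have "\<sigma> \<in> reduced_decomps n w \<and> (\<exists>t. symdiff (orient \<sigma>) (orient \<rho>) \<subseteq> {t})"
  proof (cases "short_braid \<rho> \<sigma>")
    case True
    then show ?thesis using short_braid_reduced short_braid_orient assms(2) by auto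
  next
    case False
    then obtain k where k: "long_braid_at k \<rho> \<sigma>" using assms(1) unfolding braid_move_def by blast
    have "symdiff (orient \<sigma>) (orient \<rho>) \<subseteq> {place_triple \<rho> k}"
      unfolding long_braid_effect(2)[OF k assms(2)] by auto
    with long_braid_effect(1)[OF k assms(2)] show ?thesis by blast
  qed
  then show "\<sigma> \<in> reduced_decomps n w" "\<exists>t. symdiff (orient \<sigma>) (orient \<rho>) \<subseteq> {t}" by auto
qed

text \<open>Every step along a path of braid moves enlarges the set of disputed triples by at most one, and
  only by reaching a new orientation.\<close>

definition disputed :: "'a set set \<Rightarrow> 'a set" where
  "disputed S = {t. \<exists>A \<in> S. \<exists>B \<in> S. t \<in> A \<and> t \<notin> B}"

lemma disputed_subset_patterns:
  assumes "S \<subseteq> orient ` reduced_decomps n w"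
  shows "disputed S \<subseteq> patterns_321 n w"
proof
  fix t assume "t \<in> disputed S"
  then obtain A where "A \<in> S" "t \<in> A" by (auto simp: disputed_def)
  with assms obtain \<rho> where "\<rho> \<in> reduced_decomps n w" "t \<in> orient \<rho>" by blast
  then show "t \<in> patterns_321 n w" using orient_subset_patterns by blast
qed

text \<open>The inequality says that at least as many orientations are gained as triples become
  disputed; it is stated additively to avoid truncated subtraction.\<close>

lemma extend_along_path:
  assumes "braid_move\<^sup>*\<^sup>* \<rho> \<sigma>" "\<rho> \<in> reduced_decomps n w" "orient \<rho> \<in> S"
    and "S \<subseteq> orient ` reduced_decomps n w"
  shows "\<sigma> \<in> reduced_decomps n w \<and> (\<exists>S'. S \<subseteq> S' \<and> S' \<subseteq> orient ` reduced_decomps n w \<and> orient \<sigma> \<in> S' \<and>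
           card (disputed S') + card S \<le> card (disputed S) + card S')"
  using assms(1)
proof (induction rule: rtranclp_induct)
  case base
  then show ?case using assms by auto
next
  case (step \<sigma> \<sigma>')
  then obtain S' where S': "S \<subseteq> S'" "S' \<subseteq> orient ` reduced_decomps n w" "orient \<sigma> \<in> S'"
    "card (disputed S') + card S \<le> card (disputed S) + card S'"
    and \<sigma>: "\<sigma> \<in> reduced_decomps n w" by blast
  have \<sigma>': "\<sigma>' \<in> reduced_decomps n w" by (rule braid_move_orient(1)[OF step.hyps(2) \<sigma>])
  obtain t where t: "symdiff (orient \<sigma>') (orient \<sigma>) \<subseteq> {t}"
    using braid_move_orient(2)[OF step.hyps(2) \<sigma>] by blast
  show ?case
  proof (cases "orient \<sigma>' \<in> S'")
    case True
    with S' \<sigma>' show ?thesis by blast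
  next
    case False
    have fin: "finite S'" by (rule finite_subset[OF S'(2) finite_imageI[OF finite_reduced_decomps]])
    have fin': "finite (disputed S')"
      by (rule finite_subset[OF disputed_subset_patterns[OF S'(2)] finite_patterns_321])
    \<comment> \<open>The new orientation differs from \<open>orient \<sigma>\<close>, already in
      \<open>S'\<close>, at most in \<open>t\<close>.\<close>
    have "disputed (insert (orient \<sigma>') S') \<subseteq> insert t (disputed S')"
      using t S'(3) unfolding disputed_def by blast
    then have "card (disputed (insert (orient \<sigma>') S')) \<le> card (insert t (disputed S'))"
      using fin' by (intro card_mono) auto
    also have "\<dots> \<le> Suc (card (disputed S'))" using fin' by (simp add: card_insert_if)
    finally have "card (disputed (insert (orient \<sigma>') S')) + card S
        \<le> card (disputed S) + card (insert (orient \<sigma>') S')"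
      using S'(4) False fin by simp
    moreover have "insert (orient \<sigma>') S' \<subseteq> orient ` reduced_decomps n w" using S'(2) \<sigma>' by blast
    ultimately show ?thesis
      using \<sigma>' S'(1) by (intro conjI exI[of _ "insert (orient \<sigma>') S'"]) auto
  qed
qed

text \<open>Paths from \<open>S\<close> to the word orienting all patterns, and on to the word
  orienting none, make every pattern disputed.\<close>

lemma card_orientations_ge:
  assumes w: "w permutes {1..n}" and S: "S \<subseteq> orient ` reduced_decomps n w" "S \<noteq> {}"
  shows "num_321_patterns n w + card S \<le> card (disputed S) + card (orient ` reduced_decomps n w)"
proof -
  obtain \<rho> where \<rho>: "\<rho> \<in> reduced_decomps n w" "orient \<rho> \<in> S" using S by blast
  obtain \<sigma> where \<sigma>: "\<sigma> \<in> reduced_decomps n w" "patterns_321 n w \<subseteq> orient \<sigma>"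
    using ex_reduced_decomp_orient_full[OF w] by blast
  obtain \<tau> where \<tau>: "\<tau> \<in> reduced_decomps n w" "orient \<tau> = {}"
    using ex_reduced_decomp_orient_empty[OF w] by blast
  obtain S' where S': "S \<subseteq> S'" "S' \<subseteq> orient ` reduced_decomps n w" "orient \<sigma> \<in> S'"
    "card (disputed S') + card S \<le> card (disputed S) + card S'"
    using extend_along_path[OF braid_connected[OF \<rho>(1) \<sigma>(1)] \<rho> S(1)] by blast
  obtain S'' where S'': "S' \<subseteq> S''" "S'' \<subseteq> orient ` reduced_decomps n w" "orient \<tau> \<in> S''"
    "card (disputed S'') + card S' \<le> card (disputed S') + card S''"
    using extend_along_path[OF braid_connected[OF \<sigma>(1) \<tau>(1)] \<sigma>(1) S'(3,2)] by blast
  have "disputed S'' \<subseteq> patterns_321 n w" by (rule disputed_subset_patterns[OF S''(2)])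
  moreover have "patterns_321 n w \<subseteq> disputed S''"
  proof
    fix t assume "t \<in> patterns_321 n w"
    then have "t \<in> orient \<sigma>" "t \<notin> orient \<tau>" using \<sigma>(2) \<tau>(2) by auto
    moreover have "orient \<sigma> \<in> S''" using S'(3) S''(1) by (rule rev_subsetD)
    ultimately show "t \<in> disputed S''" using S''(3) unfolding disputed_def by blast
  qed
  ultimately have "card (disputed S'') = num_321_patterns n w"
    using card_patterns_321[OF w] by simp
  moreover have "card S'' \<le> card (orient ` reduced_decomps n w)"
    by (intro card_mono S''(2)) (simp add: finite_reduced_decomps)
  ultimately show ?thesis using S'(4) S''(4) by linarith
qed

text \<open>\<open>orient\<close> is constant on commutation classes, so evaluating it at
  representatives reaches every orientation.\<close>

lemma card_orientations_le: "card (orient ` reduced_decomps n w) \<le> card (commutation_classes n w)"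
proof (rule surj_card_le)
  show "finite (commutation_classes n w)"
    unfolding commutation_classes_def
    by (rule finite_quotient[OF finite_reduced_decomps]) (auto simp: commutation_rel_def)
  show "orient ` reduced_decomps n w \<subseteq> (\<lambda>C. orient (SOME \<rho>. \<rho> \<in> C)) ` commutation_classes n w"
  proof
    fix A assume "A \<in> orient ` reduced_decomps n w"
    then obtain \<rho> where \<rho>: "\<rho> \<in> reduced_decomps n w" "A = orient \<rho>" by blast
    let ?C = "commutation_rel n w `` {\<rho>}"
    have inv: "orient \<sigma> = orient \<rho>" if "short_braid\<^sup>*\<^sup>* \<rho> \<sigma>" for \<sigma>
      using that by (induction rule: rtranclp_induct) (auto dest: short_braid_orient)
    have "orient \<sigma> = A" if "\<sigma> \<in> ?C" for \<sigma>
      unfolding \<rho>(2) by (rule inv) (use that in \<open>simp add: commutation_rel_def\<close>)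
    moreover have "\<rho> \<in> ?C" using \<rho>(1) by (simp add: commutation_rel_def)
    ultimately have "orient (SOME \<sigma>. \<sigma> \<in> ?C) = A" using someI[of "\<lambda>\<sigma>. \<sigma> \<in> ?C" \<rho>] by blast
    moreover have "?C \<in> commutation_classes n w"
      unfolding commutation_classes_def using \<rho>(1) by (rule quotientI)
    ultimately show "A \<in> (\<lambda>C. orient (SOME \<rho>. \<rho> \<in> C)) ` commutation_classes n w"
      by (intro image_eqI[where x = ?C]) simp_all
  qed
qed

text \<open>The \<open>2 ^ y\<close> vertices of a cube dispute at most \<open>y\<close> patterns,
  and \<open>card_orientations_ge\<close> supplies the rest. Here \<open>y\<close> is
  \<lceil>Y/2\<rceil>.\<close>

lemma card_commutation_classes_ge:
  assumes w: "w permutes {1..n}"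
  defines "y \<equiv> (max_long_braids n w + 1) div 2"
  shows "2 ^ y + num_321_patterns n w \<le> card (commutation_classes n w) + y"
proof -
  have "max_long_braids n w \<in> num_long_braids ` reduced_decomps n w"
    unfolding max_long_braids_def using reduced_decomps_nonempty[OF w]
    by (intro Max_in) (auto simp: finite_reduced_decomps)
  then obtain \<rho> where \<rho>: "\<rho> \<in> reduced_decomps n w" "max_long_braids n w = card (places \<rho>)"
    by (auto simp: num_long_braids_def places_def)
  obtain K' where K': "K' \<subseteq> places \<rho>" "card (places \<rho>) \<le> 2 * card K'"
    "\<forall>k \<in> K'. \<forall>l \<in> K'. k < l \<longrightarrow> k + 3 \<le> l"
    using separated_subset[OF finite_places places_not_consecutive[OF \<rho>(1)]] by blast
  have "y \<le> card K'" using K'(2) \<rho>(2) by (simp add: y_def)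
  \<comment> \<open>\<open>K'\<close> may be larger; exactly \<open>y\<close> places are kept so
    that the cube has \<open>2 ^ y\<close> vertices.\<close>
  then obtain K where K: "K \<subseteq> K'" "card K = y" by (meson obtain_subset_with_card_n)
  have KP: "K \<subseteq> places \<rho>" using K K' by blast
  have sep: "\<forall>k \<in> K. \<forall>l \<in> K. k < l \<longrightarrow> k + 3 \<le> l" using K K' by blast
  have fin: "finite K" using KP finite_places finite_subset by blast
  define T where "T = place_triple \<rho> ` K"
  have T: "finite T" "card T = y"
    using fin K(2) card_image[OF inj_on_subset[OF place_triple_inj[OF \<rho>(1)] KP]]
    by (simp_all add: T_def)
  \<comment> \<open>The cube: \<open>orient \<rho>\<close> with any subset of the triples in
    \<open>T\<close> toggled. Its members agree outside \<open>T\<close>.\<close>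
  define Q where "Q = symdiff (orient \<rho>) ` Pow T"
  have sub: "Q \<subseteq> orient ` reduced_decomps n w"
  proof
    fix A assume "A \<in> Q"
    then obtain U where U: "U \<subseteq> T" "A = symdiff (orient \<rho>) U" by (auto simp: Q_def)
    then obtain L where L: "L \<subseteq> K" "U = place_triple \<rho> ` L"
      unfolding T_def by (auto simp: subset_image_iff)
    obtain \<sigma> where "\<sigma> \<in> reduced_decomps n w" "orient \<sigma> = A"
      using braid_cube[OF \<rho>(1) KP finite_subset[OF L(1) fin] L(1) sep] U(2) L(2) by blast
    then show "A \<in> orient ` reduced_decomps n w" by blast
  qed
  have "inj_on (symdiff (orient \<rho>)) (Pow T)" by (rule inj_onI) blast
  then have card_Q: "card Q = 2 ^ y" by (simp add: Q_def card_image card_Pow T)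
  have "disputed Q \<subseteq> T" by (auto simp: disputed_def Q_def)
  then have "card (disputed Q) \<le> y" using T card_mono by blast
  moreover have "Q \<noteq> {}" by (auto simp: Q_def)
  ultimately show ?thesis
    using card_orientations_ge[OF w sub] card_orientations_le[of n w] card_Q by simp
qed

section \<open>The last move at each position\<close>

text \<open>The letters affecting position \<open>p\<close>. The subtraction is truncated only at \<open>p = 0\<close>.\<close>

definition proj :: "nat list \<Rightarrow> nat \<Rightarrow> nat list" where
  "proj \<rho> p = filter (\<lambda>x. x = p - 1 \<or> x = p) \<rho>"

lemma proj_append [simp]: "proj (\<rho> @ \<sigma>) p = proj \<rho> p @ proj \<sigma> p"
  by (simp add: proj_def)

lemma proj_Nil [simp]: "proj [] p = []"
  by (simp add: proj_def)

lemma proj_Cons: "proj (i # \<rho>) p = (if i = p - 1 \<or> i = p then i # proj \<rho> p else proj \<rho> p)"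
  by (simp add: proj_def)

lemma short_braids_append:
  "short_braid\<^sup>*\<^sup>* \<rho> \<sigma> \<Longrightarrow> short_braid\<^sup>*\<^sup>* (\<rho> @ \<tau>) (\<sigma> @ \<tau>)"
proof (induction rule: rtranclp_induct)
  case (step \<sigma> \<sigma>')
  show ?case
    by (rule rtranclp.rtrancl_into_rtrancl[OF step.IH short_braid_append[OF step.hyps(2)]])
qed simp

lemma short_braids_reduced:
  "short_braid\<^sup>*\<^sup>* \<rho> \<sigma> \<Longrightarrow> \<rho> \<in> reduced_decomps n w \<Longrightarrow> \<sigma> \<in> reduced_decomps n w"
  by (induction rule: rtranclp_induct) (auto intro: short_braid_reduced)

lemma short_braids_move_to_end:
  assumes "\<And>x. x \<in> set \<beta> \<Longrightarrow> x + 2 \<le> i \<or> i + 2 \<le> x"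
  shows "short_braid\<^sup>*\<^sup>* (\<alpha> @ i # \<beta>) (\<alpha> @ \<beta> @ [i])"
  using assms
proof (induction \<beta> arbitrary: \<alpha>)
  case (Cons x \<beta>)
  have "short_braid (\<alpha> @ i # x # \<beta>) (\<alpha> @ x # i # \<beta>)"
    unfolding short_braid_def using Cons.prems[of x]
    by (intro exI[of _ \<alpha>] exI[of _ \<beta>] exI[of _ i] exI[of _ x]) auto
  moreover have "short_braid\<^sup>*\<^sup>* ((\<alpha> @ [x]) @ i # \<beta>) ((\<alpha> @ [x]) @ \<beta> @ [i])"
    using Cons by (intro Cons.IH) auto
  ultimately show ?case by (simp add: converse_rtranclp_into_rtranclp)
qed simp

text \<open>The value \<open>0\<close>, which is not a letter, stands for a position that is never moved.\<close>

definition last_move :: "nat list \<Rightarrow> nat \<Rightarrow> nat" where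
  "last_move \<rho> p = last (0 # proj \<rho> p)"

lemma last_move_Nil [simp]: "last_move [] p = 0"
  by (simp add: last_move_def)

lemma last_move_snoc:
  "last_move (\<rho> @ [i]) p = (if i = p - 1 \<or> i = p then i else last_move \<rho> p)"
  by (auto simp: last_move_def proj_Cons)

text \<open>If \<open>i\<close> is the last move at both positions \<open>i\<close> and \<open>i + 1\<close>, all later letters commute
  with the last \<open>i\<close>.\<close>

lemma move_to_end:
  assumes "1 \<le> i" "last_move \<sigma> i = i" "last_move \<sigma> (Suc i) = i"
  obtains \<tau> where "short_braid\<^sup>*\<^sup>* \<sigma> (\<tau> @ [i])" "\<And>p. proj \<sigma> p = proj (\<tau> @ [i]) p"
proof -
  have "\<exists>\<tau>. short_braid\<^sup>*\<^sup>* \<sigma> (\<tau> @ [i]) \<and> (\<forall>p. proj \<sigma> p = proj (\<tau> @ [i]) p)"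
    using assms(2,3)
  proof (induction \<sigma> rule: rev_induct)
    case Nil
    then show ?case using assms(1) by simp
  next
    case (snoc x \<sigma>)
    show ?case
    proof (cases "x = i")
      case True
      then show ?thesis by (intro exI[of _ \<sigma>]) simp
    next
      case False
      \<comment> \<open>Such a letter would itself be the last move at \<open>i\<close> or at
        \<open>Suc i\<close>.\<close>
      have x: "x \<noteq> i - 1" "x \<noteq> Suc i"
        using False snoc.prems assms(1) by (auto simp: last_move_snoc split: if_splits)
      then have "last_move \<sigma> i = i" "last_move \<sigma> (Suc i) = i"
        using False snoc.prems by (simp_all add: last_move_snoc)
      then obtain \<tau> where \<tau>: "short_braid\<^sup>*\<^sup>* \<sigma> (\<tau> @ [i])" "\<And>p. proj \<sigma> p = proj (\<tau> @ [i]) p"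
        using snoc.IH by blast
      have far: "x + 2 \<le> i \<or> i + 2 \<le> x" using False x by linarith
      have "short_braid\<^sup>*\<^sup>* (\<sigma> @ [x]) ((\<tau> @ [i]) @ [x])"
        by (rule short_braids_append[OF \<tau>(1)])
      also have "short_braid\<^sup>*\<^sup>* \<dots> ((\<tau> @ [x]) @ [i])"
        using short_braids_move_to_end[of "[x]" i \<tau>] far by simp
      finally have "short_braid\<^sup>*\<^sup>* (\<sigma> @ [x]) ((\<tau> @ [x]) @ [i])" .
      moreover have "proj (\<sigma> @ [x]) p = proj ((\<tau> @ [x]) @ [i]) p" for p
        using \<tau>(2)[of p] far by (auto simp: proj_Cons)
      ultimately show ?thesis by blast
    qed
  qed
  then show thesis using that by blast
qed

text \<open>Letters that do not commute are equal or adjacent, so some projection shows their order.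
  The last letter of \<open>\<rho>\<close> also ends two projections of \<open>\<sigma>\<close>,
  hence can be moved to the end there and cancelled. Letter \<open>0\<close> is excluded because it
  is the default of \<open>last_move\<close>.\<close>

lemma proj_eq_imp_short_braids:
  assumes "\<And>p. proj \<rho> p = proj \<sigma> p" "0 \<notin> set \<rho>"
  shows "short_braid\<^sup>*\<^sup>* \<sigma> \<rho>"
  using assms
proof (induction \<rho> arbitrary: \<sigma> rule: rev_induct)
  case Nil
  have "x \<notin> set \<sigma>" for x
    using Nil(1)[of x, symmetric] by (auto simp: proj_def filter_empty_conv)
  then have "\<sigma> = []" by (cases \<sigma>) auto
  then show ?case by simp
next
  case (snoc i \<rho>)
  have "1 \<le> i" using snoc.prems(2) by (cases i) auto
  moreover have "proj \<sigma> i = proj \<rho> i @ [i]" "proj \<sigma> (Suc i) = proj \<rho> (Suc i) @ [i]"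
    using snoc.prems(1)[symmetric] by (simp_all add: proj_Cons)
  then have "last_move \<sigma> i = i" "last_move \<sigma> (Suc i) = i"
    by (simp_all add: last_move_def)
  ultimately obtain \<tau> where \<tau>: "short_braid\<^sup>*\<^sup>* \<sigma> (\<tau> @ [i])" "\<And>p. proj \<sigma> p = proj (\<tau> @ [i]) p"
    using move_to_end by blast
  have "proj \<rho> p = proj \<tau> p" for p
    using snoc.prems(1)[of p] \<tau>(2)[of p] by (simp add: proj_Cons split: if_splits)
  moreover have "0 \<notin> set \<rho>" using snoc.prems(2) by simp
  ultimately have "short_braid\<^sup>*\<^sup>* \<tau> \<rho>" using snoc.IH by blast
  with \<tau>(1) show ?case using short_braids_append[of \<tau> \<rho> "[i]"] by (rule_tac rtranclp_trans)
qed

text \<open>Representatives with equal projections are joined by short braid moves, so their classes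
  coincide.\<close>

lemma card_commutation_classes_le:
  "card (commutation_classes n w) \<le> card (proj ` reduced_decomps n w)"
proof (rule card_inj_on_le)
  let ?R = "commutation_rel n w" and ?f = "\<lambda>C. proj (SOME \<rho>. \<rho> \<in> C)"
  have some: "(SOME \<rho>. \<rho> \<in> C) \<in> C \<and> (SOME \<rho>. \<rho> \<in> C) \<in> reduced_decomps n w \<and> C = ?R `` {SOME \<rho>. \<rho> \<in> C}"
    if C: "C \<in> commutation_classes n w" for C
  proof -
    obtain \<rho> where \<rho>: "C = ?R `` {\<rho>}" "\<rho> \<in> reduced_decomps n w"
      using C unfolding commutation_classes_def quotient_def by blast
    then have "\<rho> \<in> C" by (simp add: commutation_rel_def)
    then have s: "(SOME \<rho>. \<rho> \<in> C) \<in> C" by (rule someI)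
    have rel: "(\<rho>, SOME \<rho>. \<rho> \<in> C) \<in> ?R"
      using s \<rho>(1) by blast
    then have "?R `` {\<rho>} = ?R `` {SOME \<rho>. \<rho> \<in> C}"
      by (rule equiv_class_eq[OF equiv_commutation_rel])
    then have "C = ?R `` {SOME \<rho>. \<rho> \<in> C}" using \<rho>(1) by (rule trans[rotated])
    moreover have "(SOME \<rho>. \<rho> \<in> C) \<in> reduced_decomps n w"
      using rel unfolding commutation_rel_def by blast
    ultimately show ?thesis using s by (intro conjI)
  qed
  show "inj_on ?f (commutation_classes n w)"
  proof (rule inj_onI)
    fix C D assume C: "C \<in> commutation_classes n w" and D: "D \<in> commutation_classes n w" and eq: "?f C = ?f D"
    let ?c = "SOME \<rho>. \<rho> \<in> C" and ?d = "SOME \<rho>. \<rho> \<in> D"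
    have "0 \<notin> set ?c" using some[OF C] by (auto simp: reduced_decomps_def)
    then have "short_braid\<^sup>*\<^sup>* ?d ?c"
      using eq by (intro proj_eq_imp_short_braids) simp_all
    then have "(?d, ?c) \<in> ?R" using some[OF C] some[OF D] by (simp add: commutation_rel_def)
    then have "?R `` {?d} = ?R `` {?c}" by (rule equiv_class_eq[OF equiv_commutation_rel])
    then show "C = D" using some[OF C] some[OF D] by simp
  qed
  show "?f ` commutation_classes n w \<subseteq> proj ` reduced_decomps n w" using some by blast
qed (simp add: finite_reduced_decomps)

section \<open>Possible last moves and mixed positions\<close>

definition larger_left :: "(nat \<Rightarrow> nat) \<Rightarrow> nat \<Rightarrow> bool" where
  "larger_left w p \<longleftrightarrow> (\<exists>j<p. w p < w j)"

definition smaller_right :: "(nat \<Rightarrow> nat) \<Rightarrow> nat \<Rightarrow> bool" where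
  "smaller_right w p \<longleftrightarrow> (\<exists>j>p. w j < w p)"

text \<open>Both swapped positions lie on the same side of \<open>p\<close>. One implication is
  proved for all \<open>v\<close>; the other is its instance at
  \<open>w \<circ> adj_transp i\<close>, since the swap is an involution.\<close>

lemma larger_left_adj_transp:
  assumes "p \<noteq> i" "p \<noteq> Suc i"
  shows "larger_left (w \<circ> adj_transp i) p \<longleftrightarrow> larger_left w p"
proof -
  have p: "adj_transp i p = p" using assms by (rule adj_transp_other)
  have lt: "adj_transp i j < p" if "j < p" for j
    using adj_transp_less[of j p i] that assms p by simp
  have "larger_left v p" if v: "larger_left (v \<circ> adj_transp i) p" for v
  proof -
    obtain j where "j < p" "v p < v (adj_transp i j)"
      using v p by (auto simp: larger_left_def)
    with lt[of j] show ?thesis unfolding larger_left_def by blast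
  qed
  from this[of w] this[of "w \<circ> adj_transp i"] show ?thesis
    unfolding comp_adj_transp_twice by blast
qed

lemma smaller_right_adj_transp:
  assumes "p \<noteq> i" "p \<noteq> Suc i"
  shows "smaller_right (w \<circ> adj_transp i) p \<longleftrightarrow> smaller_right w p"
proof -
  have p: "adj_transp i p = p" using assms by (rule adj_transp_other)
  have lt: "p < adj_transp i j" if "p < j" for j
    using adj_transp_less[of p j i] that assms p by simp
  have "smaller_right v p" if v: "smaller_right (v \<circ> adj_transp i) p" for v
  proof -
    obtain j where "p < j" "v (adj_transp i j) < v p"
      using v p by (auto simp: smaller_right_def)
    with lt[of j] show ?thesis unfolding smaller_right_def by blast
  qed
  from this[of w] this[of "w \<circ> adj_transp i"] show ?thesis
    unfolding comp_adj_transp_twice by blast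
qed

text \<open>The entry \<open>w i\<close> now stands at \<open>Suc i\<close>, and the only entry
  newly on its left is smaller.\<close>

lemma larger_left_Suc_adj_transp:
  assumes "w (Suc i) < w i"
  shows "larger_left (w \<circ> adj_transp i) (Suc i) \<longleftrightarrow> larger_left w i"
  using assms unfolding larger_left_def by (auto simp: less_Suc_eq adj_transp_other)

lemma smaller_right_adj_transp_same:
  assumes "w (Suc i) < w i"
  shows "smaller_right (w \<circ> adj_transp i) i \<longleftrightarrow> smaller_right w (Suc i)"
proof -
  have "w (adj_transp i j) < w (Suc i) \<longleftrightarrow> Suc i < j \<and> w j < w (Suc i)" if "i < j" for j
    using that assms by (cases "j = Suc i") (auto simp: adj_transp_other)
  then have "smaller_right (w \<circ> adj_transp i) i \<longleftrightarrow> (\<exists>j>i. Suc i < j \<and> w j < w (Suc i))"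
    unfolding smaller_right_def by auto
  also have "\<dots> \<longleftrightarrow> smaller_right w (Suc i)"
    unfolding smaller_right_def using Suc_lessD by blast
  finally show ?thesis .
qed

text \<open>The possible values of \<^const>\<open>last_move\<close>: an entry arriving at \<open>p\<close> from the left has just
  passed a larger entry, one arriving from the right a smaller entry.\<close>

definition last_moves :: "(nat \<Rightarrow> nat) \<Rightarrow> nat \<Rightarrow> nat set" where
  "last_moves w p = {b. b = 0 \<and> \<not> larger_left w p \<and> \<not> smaller_right w p \<or>
     0 < b \<and> b = p - 1 \<and> larger_left w p \<or> b = p \<and> smaller_right w p}"

text \<open>A final \<open>i\<close> witnesses a smaller entry to the right of \<open>i\<close> and
  a larger one to the left of \<open>Suc i\<close>; other positions are inherited from the shorter
  word.\<close>

lemma last_move_in_last_moves: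
  "\<rho> \<in> reduced_decomps n w \<Longrightarrow> 1 \<le> p \<Longrightarrow> last_move \<rho> p \<in> last_moves w p"
proof (induction \<rho> arbitrary: w rule: rev_induct)
  case Nil
  then have "w = id" by (auto simp: reduced_decomps_def)
  then show ?case by (simp add: last_moves_def larger_left_def smaller_right_def)
next
  case (snoc i \<rho>)
  then have i: "1 \<le> i" "i < n" "w (Suc i) < w i"
    and \<rho>: "\<rho> \<in> reduced_decomps n (w \<circ> adj_transp i)"
    by (simp_all add: reduced_decomps_snoc_iff)
  consider "p = i" | "p = Suc i" | "p \<noteq> i" "p \<noteq> Suc i" by blast
  then show ?case
  proof cases
    case 1
    then have "smaller_right w p" using i(3) unfolding smaller_right_def by blast
    then show ?thesis using 1 by (simp add: last_move_snoc last_moves_def)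
  next
    case 2
    then have "larger_left w p" using i(3) unfolding larger_left_def by blast
    then show ?thesis using 2 i(1) by (simp add: last_move_snoc last_moves_def)
  next
    case 3
    then have "last_move (\<rho> @ [i]) p = last_move \<rho> p" using snoc.prems(2) by (auto simp: last_move_snoc)
    moreover have "last_moves (w \<circ> adj_transp i) p = last_moves w p"
      unfolding last_moves_def larger_left_adj_transp[OF 3] smaller_right_adj_transp[OF 3] ..
    ultimately show ?thesis
      using snoc.IH[OF \<rho> snoc.prems(2)] by metis
  qed
qed

lemma finite_last_moves [simp]: "finite (last_moves w p)"
  by (rule finite_subset[of _ "{0, p - 1, p}"]) (auto simp: last_moves_def)

lemma card_last_moves_le:
  "card (last_moves w p) \<le> (if larger_left w p \<and> smaller_right w p then 2 else 1)"
proof (cases "larger_left w p \<and> smaller_right w p")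
  case True
  then have "last_moves w p \<subseteq> {p - 1, p}" by (auto simp: last_moves_def)
  then have "card (last_moves w p) \<le> card {p - 1, p}" by (intro card_mono) auto
  also have "\<dots> \<le> 2" by (simp add: card_insert_if)
  finally show ?thesis using True by simp
next
  case False
  have "last_moves w p \<subseteq> {if smaller_right w p then p else if larger_left w p then p - 1 else 0}"
    using False by (auto simp: last_moves_def)
  then have "card (last_moves w p) \<le> card {if smaller_right w p then p else if larger_left w p then p - 1 else 0}"
    by (intro card_mono) auto
  then show ?thesis using False by auto
qed

text \<open>The middle positions of 321-patterns, where \<open>last_moves\<close> leaves two
  choices.\<close>

definition mixed :: "nat \<Rightarrow> (nat \<Rightarrow> nat) \<Rightarrow> nat set" where
  "mixed n w = {p \<in> {1..n}. larger_left w p \<and> smaller_right w p}"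

lemma card_mixed_split:
  assumes "1 \<le> i" "i < n"
  shows "card (mixed n w) = card (mixed n w - {i, Suc i}) +
    of_bool (larger_left w i \<and> smaller_right w i) +
    of_bool (larger_left w (Suc i) \<and> smaller_right w (Suc i))"
proof -
  have fin: "finite (mixed n w)" by (simp add: mixed_def)
  have "card (mixed n w) = card (mixed n w - {i, Suc i}) + card (mixed n w \<inter> {i, Suc i})"
    using card_Int_Diff[OF fin, of "{i, Suc i}"] by simp
  also have "mixed n w \<inter> {i, Suc i} =
      (if larger_left w i \<and> smaller_right w i then {i} else {}) \<union>
      (if larger_left w (Suc i) \<and> smaller_right w (Suc i) then {Suc i} else {})"
    using assms by (auto simp: mixed_def)
  finally show ?thesis by simp
qed

text \<open>If a position ceases to be mixed when the swap at \<open>i\<close> is undone, its last move is forced to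
  be \<open>i\<close>, so that at most one pair remains.\<close>

lemma card_last_move_pairs:
  assumes i: "1 \<le> i" "i < n" "w (Suc i) < w i"
  defines "v \<equiv> w \<circ> adj_transp i"
  defines "C \<equiv> {(b, c) \<in> last_moves v i \<times> last_moves v (Suc i). \<not> (b = i \<and> c = i)}"
  shows "card C * 2 ^ card (mixed n w) \<le> 3 * 2 ^ card (mixed n v)"
proof -
  let ?A = "larger_left w i" and ?B = "smaller_right w (Suc i)"
  let ?A' = "smaller_right v (Suc i)" and ?B' = "larger_left v i"
  let ?M = "last_moves v i" and ?N = "last_moves v (Suc i)"
  \<comment> \<open>In \<open>v\<close> the entry of position \<open>i\<close> stands at
    \<open>Suc i\<close> and vice versa; the former keeps its larger entries on the left, the latter
    its smaller entries on the right.\<close>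
  have vA: "larger_left v (Suc i) \<longleftrightarrow> ?A" and vB: "smaller_right v i \<longleftrightarrow> ?B"
    unfolding v_def using i(3)
    by (rule larger_left_Suc_adj_transp, rule smaller_right_adj_transp_same)
  have wi: "smaller_right w i" "larger_left w (Suc i)"
    using i(3) unfolding smaller_right_def larger_left_def by blast+
  have "mixed n w - {i, Suc i} = mixed n v - {i, Suc i}"
    unfolding mixed_def v_def using larger_left_adj_transp smaller_right_adj_transp by auto
  then obtain z where
    w: "card (mixed n w) = z + of_bool ?A + of_bool ?B" and
    v: "card (mixed n v) = z + of_bool (?B' \<and> ?B) + of_bool (?A \<and> ?A')"
    using card_mixed_split[OF i(1,2), of w] card_mixed_split[OF i(1,2), of v] wi vA vB by simp
  \<comment> \<open>An entry that was mixed in \<open>w\<close> but is not in \<open>v\<close> can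
    only have come from the other side, by letter \<open>i\<close>.\<close>
  have M: "?M = {i}" if "?B" "\<not> ?B'" using that vB by (auto simp: last_moves_def)
  have N: "?N = {i}" if "?A" "\<not> ?A'" using that vA i(1) by (auto simp: last_moves_def)
  have cM: "card ?M \<le> (if ?B' \<and> ?B then 2 else 1)" using card_last_moves_le[of v i] vB by simp
  have cN: "card ?N \<le> (if ?A \<and> ?A' then 2 else 1)" using card_last_moves_le[of v "Suc i"] vA by simp
  have C_le: "card C \<le> card X" if "C \<subseteq> X" "finite X" for X
    using that by (intro card_mono)
  have prod: "card C \<le> card ?M * card ?N"
    using C_le[of "?M \<times> ?N"] by (auto simp: C_def card_cartesian_product)
  \<comment> \<open>Cases: mixedness is lost by both entries, by the one from \<open>i\<close> only,
    by the one from \<open>Suc i\<close> only, or by neither.\<close>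
  consider "?A" "\<not> ?A'" "?B" "\<not> ?B'" | "?A" "\<not> ?A'" "\<not> (?B \<and> \<not> ?B')"
    | "\<not> (?A \<and> \<not> ?A')" "?B" "\<not> ?B'" | "\<not> (?A \<and> \<not> ?A')" "\<not> (?B \<and> \<not> ?B')" by blast
  then show ?thesis
  proof cases
    case 1
    then have "C = {}" using M N by (auto simp: C_def)
    then show ?thesis by simp
  next
    case 2
    have "card C \<le> 1"
    proof (cases "?B")
      case True
      have "C \<subseteq> (?M - {i}) \<times> {i}" using N[OF 2(1,2)] by (auto simp: C_def)
      then have "card C \<le> card (?M - {i})"
        using C_le[of "(?M - {i}) \<times> {i}"] by (simp add: card_cartesian_product)
      also have "\<dots> \<le> 1"
        using cM True vB by (subst card_Diff_singleton) (auto simp: last_moves_def split: if_splits)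
      finally show ?thesis .
    next
      case False
      then have "card ?M \<le> 1" "card ?N \<le> 1" using cM cN 2 by simp_all
      then show ?thesis using prod mult_le_mono[of "card ?M" 1 "card ?N" 1] by simp
    qed
    moreover have "card (mixed n w) = Suc (card (mixed n v))" using w v 2 by auto
    ultimately show ?thesis by simp
  next
    case 3
    have "card C \<le> 1"
    proof (cases "?A")
      case True
      have "C \<subseteq> {i} \<times> (?N - {i})" using M[OF 3(2,3)] by (auto simp: C_def)
      then have "card C \<le> card (?N - {i})"
        using C_le[of "{i} \<times> (?N - {i})"] by (simp add: card_cartesian_product)
      also have "\<dots> \<le> 1"
        using cN True vA i(1) by (subst card_Diff_singleton) (auto simp: last_moves_def split: if_splits)
      finally show ?thesis .
    next
      case False
      then have "card ?M \<le> 1" "card ?N \<le> 1" using cM cN 3 by simp_all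
      then show ?thesis using prod mult_le_mono[of "card ?M" 1 "card ?N" 1] by simp
    qed
    moreover have "card (mixed n w) = Suc (card (mixed n v))" using w v 3 by auto
    ultimately show ?thesis by simp
  next
    case 4
    have "card C \<le> 3"
    proof (cases "?A \<and> ?B")
      case True
      \<comment> \<open>Both sets contain \<open>i\<close>, so excluding \<open>(i, i)\<close>
        removes one of at most four pairs.\<close>
      then have "C \<subseteq> ?M \<times> ?N - {(i, i)}" "(i, i) \<in> ?M \<times> ?N"
        using vA vB i(1) by (auto simp: C_def last_moves_def)
      then have "card C \<le> card ?M * card ?N - 1"
        using C_le[of "?M \<times> ?N - {(i, i)}"] by (simp add: card_cartesian_product card_Diff_singleton)
      moreover have "card ?M \<le> 2" "card ?N \<le> 2" using cM cN by (auto split: if_splits)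
      then have "card ?M * card ?N \<le> 4" using mult_le_mono[of "card ?M" 2 "card ?N" 2] by simp
      ultimately show ?thesis by linarith
    next
      case False
      then have "card ?M * card ?N \<le> 2"
        using cM cN mult_le_mono[of "card ?M" 2 "card ?N" 1] mult_le_mono[of "card ?M" 1 "card ?N" 2]
        by (auto split: if_splits)
      then show ?thesis using prod by linarith
    qed
    moreover have "card (mixed n w) = card (mixed n v)" using w v 4 by auto
    ultimately show ?thesis by simp
  qed
qed

section \<open>Counting words with prescribed last moves\<close>

definition decomps_with :: "nat \<Rightarrow> (nat \<Rightarrow> nat) \<Rightarrow> (nat \<Rightarrow> nat) \<Rightarrow> nat list set" where
  "decomps_with n w \<beta> = {\<rho> \<in> reduced_decomps n w. \<forall>p \<in> {1..n}. last_move \<rho> p = \<beta> p}"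

lemma finite_decomps_with [simp]: "finite (decomps_with n w \<beta>)"
  by (rule finite_subset[OF _ finite_reduced_decomps[of n w]]) (auto simp: decomps_with_def)

text \<open>A mixed position takes part in two inversions, one on each side.\<close>

lemma mixed_empty:
  assumes w: "w permutes {1..n}" and "inversion_number n w \<le> 1"
  shows "mixed n w = {}"
proof (rule ccontr)
  assume "mixed n w \<noteq> {}"
  then obtain p j k where p: "p \<in> {1..n}" "j < p" "w p < w j" "p < k" "w k < w p"
    by (auto simp: mixed_def larger_left_def smaller_right_def)
  have "w p \<in> {1..n}" using p(1) by (simp only: permutes_in_image[OF w])
  \<comment> \<open>Outside \<open>{1..n}\<close> the permutation is the identity, so no position
    there can be such a witness.\<close>
  then have "j \<in> {1..n}" "k \<in> {1..n}"
    using permutes_not_in[OF w, of j] permutes_not_in[OF w, of k] p by fastforce+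
  with p have "{(j, p), (p, k)} \<subseteq> inversions n w" by (simp add: inversions_def)
  then have "card {(j, p), (p, k)} \<le> inversion_number n w"
    unfolding inversion_number_eq by (intro card_mono) simp_all
  with assms(2) p show False by simp
qed

text \<open>Dividing by \<open>2\<close> for every mixed position compensates exactly for the choices of last moves,
  so each letter contributes at most a factor \<open>3\<close>.\<close>

lemma card_decomps_with:
  "card (proj ` decomps_with n w \<beta>) * 2 ^ card (mixed n w) \<le> 3 ^ (inversion_number n w - 1)"
proof (induction "inversion_number n w" arbitrary: w \<beta>)
  \<comment> \<open>The exponent truncates to \<open>0\<close>: only the empty word and no mixed
    position remain.\<close>
  case 0
  show ?case
  proof (cases "decomps_with n w \<beta> = {}")
    case False
    then obtain \<rho> where "\<rho> \<in> reduced_decomps n w" by (auto simp: decomps_with_def)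
    then have "mixed n w = {}"
      by (intro mixed_empty reduced_decomps_permutes) (simp_all flip: 0)
    moreover have "decomps_with n w \<beta> \<subseteq> {[]}"
      using 0 by (auto simp: decomps_with_def reduced_decomps_def)
    then have "card (proj ` decomps_with n w \<beta>) \<le> card (proj ` {[]})"
      by (intro card_mono image_mono) auto
    ultimately show ?thesis by (simp add: 0[symmetric])
  qed simp
next
  case (Suc l)
  show ?case
  proof (cases "decomps_with n w \<beta> = {}")
    case False
    then obtain \<rho>0 where \<rho>0: "\<rho>0 \<in> decomps_with n w \<beta>" by blast
    then have "length \<rho>0 = Suc l" using Suc.hyps(2) by (simp add: decomps_with_def reduced_decomps_def)
    then obtain \<rho> i where \<rho>: "\<rho>0 = \<rho> @ [i]" by (cases \<rho>0 rule: rev_cases) auto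
    then have i: "1 \<le> i" "i < n" "w (Suc i) < w i"
      using \<rho>0 by (simp_all add: decomps_with_def reduced_decomps_snoc_iff)
    \<comment> \<open>One word ending in \<open>i\<close> determines \<open>\<beta>\<close> here, so
      every word counted has last move \<open>i\<close> at both positions.\<close>
    have \<beta>: "\<beta> i = i" "\<beta> (Suc i) = i"
      using \<rho>0 i unfolding \<rho> decomps_with_def by (auto simp: last_move_snoc dest: bspec[of _ _ i] bspec[of _ _ "Suc i"])
    define v where "v = w \<circ> adj_transp i"
    have inv: "l = inversion_number n v"
      using Suc.hyps(2) inversion_number_descent[of i n w, OF i] by (simp add: v_def)
    show ?thesis
    \<comment> \<open>For \<open>l = 0\<close> the exponents before and after the step are both
      \<open>0\<close>, so no factor \<open>3\<close> may be gained; only the word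
      \<open>[i]\<close> is possible.\<close>
    proof (cases "l = 0")
      case True
      have "\<sigma> = [i]" if "\<sigma> \<in> decomps_with n w \<beta>" for \<sigma>
      proof -
        have "length \<sigma> = 1" "last_move \<sigma> i = i"
          using that Suc.hyps(2) True \<beta> i by (auto simp: decomps_with_def reduced_decomps_def)
        then obtain j where "\<sigma> = [j]" by (auto simp: length_Suc_conv)
        with \<open>last_move \<sigma> i = i\<close> i show ?thesis
          using last_move_snoc[of "[]" j i] by (auto split: if_splits)
      qed
      then have "card (proj ` decomps_with n w \<beta>) \<le> card (proj ` {[i]})"
        by (intro card_mono image_mono) auto
      moreover have "mixed n w = {}"
        using \<rho>0 True Suc.hyps(2)
        by (intro mixed_empty reduced_decomps_permutes[of \<rho>0]) (simp_all add: decomps_with_def)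
      ultimately show ?thesis using True by (simp add: Suc.hyps(2)[symmetric])
    next
      case False
      \<comment> \<open>The possible last moves at \<open>i\<close> and \<open>Suc i\<close> once
        the final \<open>i\<close> is removed; \<open>\<gamma>\<close> updates
        \<open>\<beta>\<close> accordingly and \<open>f\<close> puts \<open>i\<close> back into the
        projections.\<close>
      define C where "C = {(b, c) \<in> last_moves v i \<times> last_moves v (Suc i). \<not> (b = i \<and> c = i)}"
      define \<gamma> where "\<gamma> = (\<lambda>(b, c). \<beta>(i := b, Suc i := c))"
      define f where "f = (\<lambda>q p. if i = p - 1 \<or> i = p then q p @ [i] else q p :: nat list)"
      have finC: "finite C"
        by (rule finite_subset[of _ "last_moves v i \<times> last_moves v (Suc i)"]) (auto simp: C_def)
      have "proj ` decomps_with n w \<beta> \<subseteq> (\<Union>bc \<in> C. f ` proj ` decomps_with n v (\<gamma> bc))"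
      proof
        fix q assume "q \<in> proj ` decomps_with n w \<beta>"
        then obtain \<sigma> where \<sigma>: "\<sigma> \<in> decomps_with n w \<beta>" "q = proj \<sigma>" by blast
        then have "last_move \<sigma> i = i" "last_move \<sigma> (Suc i) = i"
          using i \<beta> by (simp_all add: decomps_with_def)
        then obtain \<tau> where \<tau>: "short_braid\<^sup>*\<^sup>* \<sigma> (\<tau> @ [i])" "\<And>p. proj \<sigma> p = proj (\<tau> @ [i]) p"
          using move_to_end[OF i(1)] by blast
        have red: "\<tau> @ [i] \<in> reduced_decomps n w"
          using \<sigma>(1) by (intro short_braids_reduced[OF \<tau>(1)]) (simp add: decomps_with_def)
        then have \<tau>v: "\<tau> \<in> reduced_decomps n v" by (simp add: reduced_decomps_snoc_iff v_def)
        define bc where "bc = (last_move \<tau> i, last_move \<tau> (Suc i))"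
        \<comment> \<open>A second \<open>i\<close> movable to the end of \<open>\<tau>\<close>
          would make \<open>i\<close> a descent of \<open>v\<close>, where it is an ascent.\<close>
        have "\<not> (last_move \<tau> i = i \<and> last_move \<tau> (Suc i) = i)"
        proof
          assume "last_move \<tau> i = i \<and> last_move \<tau> (Suc i) = i"
          then obtain \<tau>' where "short_braid\<^sup>*\<^sup>* \<tau> (\<tau>' @ [i])" using move_to_end[OF i(1)] by blast
          then have "\<tau>' @ [i] \<in> reduced_decomps n v" using \<tau>v by (rule short_braids_reduced)
          then have "v (Suc i) < v i" by (simp add: reduced_decomps_snoc_iff)
          with i(3) show False by (simp add: v_def)
        qed
        then have "bc \<in> C"
          using last_move_in_last_moves[OF \<tau>v] i(1) by (simp add: bc_def C_def)
        moreover have "\<tau> \<in> decomps_with n v (\<gamma> bc)"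
        proof -
          have "last_move \<tau> p = \<gamma> bc p" if p: "p \<in> {1..n}" for p
          proof (cases "p = i \<or> p = Suc i")
            case False
            have "last_move \<tau> p = last_move (\<tau> @ [i]) p" using False p by (auto simp: last_move_snoc)
            also have "\<dots> = last_move \<sigma> p" by (simp only: last_move_def \<tau>(2))
            also have "\<dots> = \<beta> p" using \<sigma>(1) p by (simp add: decomps_with_def)
            finally show ?thesis using False by (simp add: \<gamma>_def bc_def)
          qed (auto simp: \<gamma>_def bc_def)
          with \<tau>v show ?thesis by (simp add: decomps_with_def)
        qed
        moreover have "q = f (proj \<tau>)"
          unfolding \<sigma>(2) using \<tau>(2) by (auto simp: f_def proj_Cons)
        ultimately show "q \<in> (\<Union>bc \<in> C. f ` proj ` decomps_with n v (\<gamma> bc))" by blast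
      qed
      then have "card (proj ` decomps_with n w \<beta>) \<le> card (\<Union>bc \<in> C. f ` proj ` decomps_with n v (\<gamma> bc))"
        using finC by (intro card_mono) auto
      also have "\<dots> \<le> (\<Sum>bc \<in> C. card (f ` proj ` decomps_with n v (\<gamma> bc)))"
        by (rule card_UN_le[OF finC])
      also have "\<dots> \<le> (\<Sum>bc \<in> C. card (proj ` decomps_with n v (\<gamma> bc)))"
        by (intro sum_mono card_image_le) simp
      finally have "card (proj ` decomps_with n w \<beta>) * 2 ^ card (mixed n v)
          \<le> (\<Sum>bc \<in> C. card (proj ` decomps_with n v (\<gamma> bc)) * 2 ^ card (mixed n v))"
        by (simp add: sum_distrib_right[symmetric])
      also have "\<dots> \<le> (\<Sum>bc \<in> C. 3 ^ (l - 1))"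
        using Suc.hyps(1)[OF inv] unfolding inv[symmetric] by (intro sum_mono)
      also have "\<dots> = card C * 3 ^ (l - 1)" by simp
      \<comment> \<open>Both weights are carried, so that \<open>card_last_move_pairs\<close> trades
        that of \<open>w\<close> for that of \<open>v\<close>, and the latter then cancels.\<close>
      finally have "card (proj ` decomps_with n w \<beta>) * 2 ^ card (mixed n v) * 2 ^ card (mixed n w)
          \<le> card C * 3 ^ (l - 1) * 2 ^ card (mixed n w)" by (rule mult_right_mono) simp
      also have "\<dots> = card C * 2 ^ card (mixed n w) * 3 ^ (l - 1)" by simp
      also have "\<dots> \<le> 3 * 2 ^ card (mixed n v) * 3 ^ (l - 1)"
        using card_last_move_pairs[OF i] unfolding C_def v_def by (intro mult_right_mono) simp_all
      also have "\<dots> = 3 ^ l * 2 ^ card (mixed n v)"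
        using False by (cases l) simp_all
      finally have "(card (proj ` decomps_with n w \<beta>) * 2 ^ card (mixed n w)) * 2 ^ card (mixed n v)
          \<le> 3 ^ l * 2 ^ card (mixed n v)" by (simp add: mult_ac)
      then have "card (proj ` decomps_with n w \<beta>) * 2 ^ card (mixed n w) \<le> 3 ^ l" by simp
      then show ?thesis by (simp add: Suc.hyps(2)[symmetric])
    qed
  qed simp
qed

text \<open>Summing \<open>card_decomps_with\<close> over the possible last moves, at most
  \<open>2 ^ card (mixed n w)\<close> many, cancels the weight.\<close>

lemma card_proj_reduced_decomps_le:
  "card (proj ` reduced_decomps n w) \<le> 3 ^ (inversion_number n w - 1)"
proof -
  let ?B = "PiE {1..n} (last_moves w)"
  have finB: "finite ?B" by (intro finite_PiE) auto
  have "proj ` reduced_decomps n w \<subseteq> (\<Union>\<beta> \<in> ?B. proj ` decomps_with n w \<beta>)"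
  proof
    fix q assume "q \<in> proj ` reduced_decomps n w"
    then obtain \<rho> where \<rho>: "\<rho> \<in> reduced_decomps n w" "q = proj \<rho>" by blast
    let ?\<beta> = "restrict (last_move \<rho>) {1..n}"
    have "?\<beta> \<in> ?B" using last_move_in_last_moves[OF \<rho>(1)] by auto
    moreover have "\<rho> \<in> decomps_with n w ?\<beta>" using \<rho>(1) by (simp add: decomps_with_def)
    ultimately show "q \<in> (\<Union>\<beta> \<in> ?B. proj ` decomps_with n w \<beta>)" using \<rho>(2) by blast
  qed
  then have "card (proj ` reduced_decomps n w) \<le> card (\<Union>\<beta> \<in> ?B. proj ` decomps_with n w \<beta>)"
    using finB by (intro card_mono) auto
  also have "\<dots> \<le> (\<Sum>\<beta> \<in> ?B. card (proj ` decomps_with n w \<beta>))" by (rule card_UN_le[OF finB])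
  finally have "card (proj ` reduced_decomps n w) * 2 ^ card (mixed n w)
      \<le> (\<Sum>\<beta> \<in> ?B. card (proj ` decomps_with n w \<beta>) * 2 ^ card (mixed n w))"
    by (simp add: sum_distrib_right[symmetric])
  also have "\<dots> \<le> (\<Sum>\<beta> \<in> ?B. 3 ^ (inversion_number n w - 1))"
    by (intro sum_mono card_decomps_with)
  also have "\<dots> = card ?B * 3 ^ (inversion_number n w - 1)" by simp
  also have "card ?B = (\<Prod>p \<in> {1..n}. card (last_moves w p))" by (rule card_PiE) simp
  also have "\<dots> \<le> (\<Prod>p \<in> {1..n}. if larger_left w p \<and> smaller_right w p then 2 else 1)"
    by (intro prod_mono conjI card_last_moves_le) simp
  also have "\<dots> = 2 ^ card (mixed n w)"
    by (simp add: prod.If_cases mixed_def Int_def)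
  finally show ?thesis by (simp add: mult.commute)
qed

text \<open>For \<open>id\<close> there is one class and \<open>3 ^ 0 = 1\<close>, so strictness
  fails; otherwise \<open>inversion_number n w - 1\<close> is a genuine predecessor. The lower bound
  is over the integers, where subtraction does not truncate.\<close>

theorem theorem3p1:
  fixes n :: nat and w :: "nat \<Rightarrow> nat"
  assumes "w permutes {1..n}"
  defines "Y \<equiv> max_long_braids n w"
  shows "2 ^ nat \<lceil>real Y / 2\<rceil> + int (num_321_patterns n w) - \<lceil>real Y / 2\<rceil>
           \<le> int (card (pverts (commutation_graph n w)))
       \<and> (w \<noteq> id \<longrightarrow> card (pverts (commutation_graph n w)) < 3 ^ inversion_number n w)"
proof (intro conjI impI)
  have verts: "pverts (commutation_graph n w) = commutation_classes n w"
    by (simp add: commutation_graph_def)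
  have ceil: "\<lceil>real Y / 2\<rceil> = int ((Y + 1) div 2)"
    by (cases "even Y") (auto elim!: evenE oddE intro!: ceiling_unique)
  have "int (2 ^ ((Y + 1) div 2) + num_321_patterns n w) \<le> int (card (commutation_classes n w) + (Y + 1) div 2)"
    using card_commutation_classes_ge[OF assms(1)] unfolding Y_def by (subst of_nat_le_iff)
  then show "2 ^ nat \<lceil>real Y / 2\<rceil> + int (num_321_patterns n w) - \<lceil>real Y / 2\<rceil>
           \<le> int (card (pverts (commutation_graph n w)))"
    unfolding ceil verts nat_int by simp
next
  assume "w \<noteq> id"
  then have "inversion_number n w \<noteq> 0" using inversion_number_eq_0_iff[OF assms(1)] by simp
  then have "(3::nat) ^ (inversion_number n w - 1) < 3 ^ inversion_number n w"
    by (intro power_strict_increasing) simp_all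
  with order_trans[OF card_commutation_classes_le card_proj_reduced_decomps_le]
  show "card (pverts (commutation_graph n w)) < 3 ^ inversion_number n w"
    unfolding commutation_graph_def pair_pre_digraph.simps by (rule le_less_trans)
qed

end
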